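(* Assume all hypotheses of Theorem 1 as stated in the context (namely: $s>7$; (A0); (A1) with $\alpha=1$; (A3) with $\rho_c=0$, $\rho_n\ge0$, $L\rho_n\le\mu$; VFOG with $t_k=k+s+1$, estimators satisfying (EB) with $\frac{2s+1}{(s+1)^2}<\kappa\le1$, and $\frac{8(s-1)\rho_n}{3s-2}\le\eta<\frac{\lambda}{L}$, $(3s^2-8s-1)\eta>8(s-1)(s-2)\rho_n$, $\gamma_k=\frac{\eta(k+s)}{(s-2)(k+s+1)}$, $\beta_k=[\frac{(s-2)\eta}{4(s-1)}+2\rho_n]\frac{k+1}{k+s+1}-\frac{\gamma_k}{k+s+1}$), and assume $\sum_{k=0}^\infty\delta_k<\infty$. Then: (a) $\sum_{k=0}^\infty(k+1)\|Gx^k+v^k\|^2<\infty$ and $\sum_{k=0}^\infty(k+s)\|Gy^{k-1}+v^k\|^2<\infty$ almost surely; (b) almost surely $\lim_{k\to\infty}k^2\|Gx^k+v^k\|^2=0$ and $\lim_{k\to\infty}k^2\|Gy^{k-1}+v^k\|^2=0$; (c) if in addition $\mathrm{gra}\,\Phi$ is closed, then $\{x^k\}$ converges almost surely to a $\mathrm{zer}\,\Phi$-valued random variable $x^\star$, and $\{y^k\}$ and $\{z^k\}$ converge almost surely to the same $x^\star$.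
   Context: Problem setting: $G:\mathbb R^p\to\mathbb R^p$ is single-valued, $T:\mathbb R^p\rightrightarrows\mathbb R^p$ is set-valued, $\Phi:=G+T$, $\mathrm{gra}\,\Phi:=\{(x,w):w\in Gx+Tx\}$, $\mathrm{zer}\,\Phi:=\{x:0\in Gx+Tx\}\neq\emptyset$. $J_{\eta T}:=(I+\eta T)^{-1}$. $G$ is accessed through a stochastic oracle: a random variable $\xi$ and maps $\mathbf G_\xi:\mathbb R^p\to\mathbb R^p$ with $\mathbb E_\xi[\mathbf G_\xi x]=Gx$ for all $x$. Assumptions. (A0) there is $\sigma\ge0$ with $\mathbb E_\xi\|\mathbf G_\xi x-Gx\|^2\le\sigma^2$ for all $x$. (A1) there are $L>0$, $\alpha\in[0,1]$ with $\alpha\|Gx-Gy\|^2+(1-\alpha)\mathbb E_\xi\|\mathbf G_\xi x-\mathbf G_\xi y\|^2\le L^2\|x-y\|^2$ for all $x,y$. (A3) there are $\rho_n\ge\rho_c\ge0$ with $\langle w_x-w_y,x-y\rangle\ge-\rho_n\|w_x-w_y\|^2+\rho_c\,\mathbb E_\xi\|\mathbf G_\xi x-\mathbf G_\xi y\|^2$ for all $(x,w_x),(y,w_y)\in\mathrm{gra}\,\Phi$. Algorithm VFOG (parameters $s>0$, $\eta>0$, $t_k$, $\beta_k$, $\gamma_k$): choose $x^0$, $v^0\in Tx^0$, set $z^0:=x^0$, $y^{-1}:=x^0$, $\widetilde Gy^{-1}:=Gx^0$. For $k\ge0$: $\hat x^k:=\frac{t_k-s}{t_k}x^k+\frac{s}{t_k}z^k$;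 $y^k:=\hat x^k-(\eta-\beta_k)(\widetilde Gy^{k-1}+v^k)$; form an estimator $\widetilde Gy^k$ of $Gy^k$; then $x^{k+1}:=J_{\eta T}\big(\hat x^k-\eta\widetilde Gy^k+\beta_k(\widetilde Gy^{k-1}+v^k)\big)$ and $v^{k+1}:=\frac1\eta\big(\hat x^k-x^{k+1}+\beta_k(\widetilde Gy^{k-1}+v^k)\big)-\widetilde Gy^k\in Tx^{k+1}$; and $z^{k+1}:=z^k-\frac{\gamma_k}{s}(\widetilde Gy^{k-1}+v^k)$. $\mathcal F_k$ is the $\sigma$-algebra generated by all randomness up to iteration $k$, $\mathbb E_k[\cdot]:=\mathbb E[\cdot\mid\mathcal F_k]$. $e^k:=\widetilde Gy^k-Gy^k$ ($e^{-1}=0$). Error condition (EB): there are $\kappa\in(0,1]$, $\Theta\ge0$, nonnegative numbers $\delta_k$ and nonnegative random variables $\Delta_k$ ($\Delta_{-1}:=0$) such that almost surely for all $k\ge0$: $\mathbb E_k\|e^k\|^2\le\mathbb E_k\Delta_k$ and $\mathbb E_k\Delta_k\le(1-\kappa)\Delta_{k-1}+\Theta L^2\|x^k-y^{k-1}\|^2+\delta_k/t_k^2$. Constants: $\Lambda_0:=\frac{s^2(16s-18)}{(s-2)[s^2-(1-\kappa)(s+1)^2]}$, $\omega:=1+\frac{2(11s-13)}{s-2}+\frac{2\Lambda_0\Theta(s+1)^2}{s^2}$, $\mu:=\frac{3s-2}{8(s-1)\sqrt{2(1+\omega)(s+1)}}$, $\lambda:=\frac{1}{\sqrt{2(1+\omega)(s+1)}}$.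 *)

theory Defs
  imports "HOL-Probability.Probability"
begin

definition gra_op :: "('a::real_vector \<Rightarrow> 'a) \<Rightarrow> ('a \<Rightarrow> 'a set) \<Rightarrow> ('a \<times> 'a) set" where
  "gra_op G T = {(x, w). w \<in> (\<lambda>u. G x + u) ` T x}"

definition zer_op :: "('a::real_vector \<Rightarrow> 'a) \<Rightarrow> ('a \<Rightarrow> 'a set) \<Rightarrow> 'a set" where
  "zer_op G T = {x. 0 \<in> (\<lambda>u. G x + u) ` T x}"

definition resolvent :: "real \<Rightarrow> ('a::real_vector \<Rightarrow> 'a set) \<Rightarrow> 'a \<Rightarrow> 'a set" where
  "resolvent \<eta> T u = {x. \<exists>w\<in>T x. u = x + \<eta> *\<^sub>R w}"

definition Lambda0 :: "real \<Rightarrow> real \<Rightarrow> real" where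
  "Lambda0 s \<kappa> = s^2 * (16 * s - 18) / ((s - 2) * (s^2 - (1 - \<kappa>) * (s + 1)^2))"

definition omega_c :: "real \<Rightarrow> real \<Rightarrow> real \<Rightarrow> real" where
  "omega_c s \<kappa> \<Theta> = 1 + 2 * (11 * s - 13) / (s - 2) + 2 * Lambda0 s \<kappa> * \<Theta> * (s + 1)^2 / s^2"

definition mu_c :: "real \<Rightarrow> real \<Rightarrow> real \<Rightarrow> real" where
  "mu_c s \<kappa> \<Theta> = (3 * s - 2) / (8 * (s - 1) * sqrt (2 * (1 + omega_c s \<kappa> \<Theta>) * (s + 1)))"

definition lambda_c :: "real \<Rightarrow> real \<Rightarrow> real \<Rightarrow> real" where
  "lambda_c s \<kappa> \<Theta> = 1 / sqrt (2 * (1 + omega_c s \<kappa> \<Theta>) * (s + 1))"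

end

theory Submission
  imports Defs
begin

text \<open>
  Write w = G x + v for the residual, u for its estimate used by the algorithm, d = w - u, and
  E_k = s t_(k-1) <w_k, x_k - z_k> + a_k |w_k|^2. Hypomonotonicity along consecutive iterates makes
  V_k = E_k + (c_k / 2) |z_k - x*|^2 decrease up to multiples of t_k^2 |d_k|^2; the coefficients c_k
  are chosen slightly decreasing so that |z_k - x*|^2 / t_k^2 pays for the cross term <d_k, z_k - x*>.
  Since d_k enters only through its square, no martingale convergence theorem is needed: adding a
  multiple of t_(k-1)^2 Delta_(k-1) and taking total expectations shows that k |w_k|^2,
  k^2 |u_(k+1) - u_k|^2 and k^2 |e^k|^2 are almost surely summable.

  The rest is pathwise. The recursion for x_k - z_k contracts by the factor 1 - s / t_k, so
  x_k - z_k tends to 0 and |x_k - z_k|^2 / k is summable; then E_k is decreasing up to a summable error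
  while E_k / k is summable, hence E_k and k^2 |w_k|^2 tend to 0. Finally V_k converges for every zero
  x*, so |z_k - x*| does too, and Opial's argument gives convergence of the iterates.
\<close>

section \<open>Inequalities and summability\<close>

text \<open>The error condition bounds only the second moment of the estimator error, so the
  estimator may be biased and inner products of \<open>d\<close> with the iterates need not vanish
  under conditional expectation. Each is turned into squares and paid for by a spare negative term
  of the descent. The cross terms of order k^2 contain \<open>w (Suc k) - w k\<close>; they are paid
  for by the square of that increment, left over because \<open>q\<close> exceeds
  \<open>\<rho>\<close>. The part of \<open>d\<close> caused by evaluating \<open>G\<close> at
  \<open>y\<close> instead of \<open>x\<close> is bounded by \<open>L * \<eta>\<close> times the
  increment of \<open>u\<close>, hence is absorbed once \<open>L * \<eta>\<close> is small: this is
  the role of \<open>lambda_c\<close>. The estimator part is controlled by \<open>Dm\<close>, whose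
  decay must beat the growth of t_k^2; the lower bound on \<open>\<kappa>\<close> says exactly this
  at the worst index k = 0. No iterate is assumed square integrable, so finiteness of the
  expectations has to be established along with the descent.\<close>

lemma inner_le_young:
  fixes a b :: "'a::real_inner"
  assumes "e > 0"
  shows "m * (a \<bullet> b) \<le> e * (norm a)\<^sup>2 + m\<^sup>2 / (4 * e) * (norm b)\<^sup>2"
proof -
  have "0 \<le> ((2 * e) *\<^sub>R a - m *\<^sub>R b) \<bullet> ((2 * e) *\<^sub>R a - m *\<^sub>R b) / (4 * e)"
    using assms by simp
  also have "\<dots> = e * (a \<bullet> a) + m\<^sup>2 / (4 * e) * (b \<bullet> b) - m * (a \<bullet> b)"
    using assms
    by (simp add: inner_diff_left inner_diff_right inner_commute power2_eq_square field_simps)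
  finally show ?thesis by (simp add: power2_norm_eq_inner)
qed

text \<open>Meant for \<open>a = w (Suc k) - w k\<close>, where \<open>a - d' + d\<close> is the
  increment of \<open>u\<close>. A quarter of its square changes the coefficients of the two mixed
  products with \<open>a\<close> to 1/2 and 1/2 - b, both of modulus at most 1/2. The weights 7/40 +
  7/40 + 1/4 use up exactly 3/5, the threshold for \<open>h\<close>; on the other side 5/14 + 1/4 +
  1/4 stays below 1.\<close>

lemma cross_terms_le:
  fixes a d d' :: "'a::real_inner"
  assumes "0 \<le> b" "b \<le> 1" "3/5 \<le> h"
  shows "a \<bullet> d' - b * (a \<bullet> d) + (norm (a - d' + d))\<^sup>2 / 4
         \<le> h * (norm a)\<^sup>2 + (norm d)\<^sup>2 + (norm d')\<^sup>2"
proof -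
  have 1: "(1/2) * (a \<bullet> d') \<le> 7/40 * (norm a)\<^sup>2 + 5/14 * (norm d')\<^sup>2"
    using inner_le_young[of "7/40" "1/2" a d'] by (simp add: power2_eq_square)
  have "(1/2 - b)\<^sup>2 \<le> (1/2)\<^sup>2"
    using assms by (intro power2_le_iff_abs_le[THEN iffD2]) (auto simp: abs_if)
  then have "(1/2 - b)\<^sup>2 / (4 * (7/40)) * (norm d)\<^sup>2 \<le> 5/14 * (norm d)\<^sup>2"
    by (intro mult_right_mono) (auto simp: power2_eq_square)
  then have 2: "(1/2 - b) * (a \<bullet> d) \<le> 7/40 * (norm a)\<^sup>2 + 5/14 * (norm d)\<^sup>2"
    using inner_le_young[of "7/40" "1/2 - b" a d] by linarith
  have 3: "(-1/2) * (d' \<bullet> d) \<le> 1/4 * (norm d')\<^sup>2 + 1/4 * (norm d)\<^sup>2"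
    using inner_le_young[of "1/4" "-1/2" d' d] by (simp add: power2_eq_square)
  have 4: "3/5 * (norm a)\<^sup>2 \<le> h * (norm a)\<^sup>2"
    using assms by (intro mult_right_mono) auto
  have N: "(norm (a - d' + d))\<^sup>2 = (norm a)\<^sup>2 + (norm d')\<^sup>2 + (norm d)\<^sup>2
      - 2 * (a \<bullet> d') + 2 * (a \<bullet> d) - 2 * (d' \<bullet> d)"
    by (simp add: power2_norm_eq_inner inner_simps inner_commute)
  have "a \<bullet> d' - b * (a \<bullet> d) + (norm (a - d' + d))\<^sup>2 / 4 =
     (1/2) * (a \<bullet> d') + (1/2 - b) * (a \<bullet> d) + (-1/2) * (d' \<bullet> d)
     + ((norm a)\<^sup>2 + (norm d')\<^sup>2 + (norm d)\<^sup>2) / 4"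
    unfolding N by (simp add: field_simps)
  also have "\<dots> \<le> 3/5 * (norm a)\<^sup>2 + (norm d)\<^sup>2 + (norm d')\<^sup>2"
    using 1 2 3 zero_le_power2[of "norm d"] zero_le_power2[of "norm d'"] by argo
  finally show ?thesis using 4 by linarith
qed

lemma norm_add_sq_le:
  fixes a b :: "'a::real_inner"
  shows "(norm (a + b))\<^sup>2 \<le> 2 * (norm a)\<^sup>2 + 2 * (norm b)\<^sup>2"
  using inner_le_young[of 1 2 a b]
  by (simp add: power2_norm_eq_inner inner_simps inner_commute)

lemma norm_diff_sq_le:
  fixes a b :: "'a::real_inner"
  shows "(norm (a - b))\<^sup>2 \<le> 2 * (norm a)\<^sup>2 + 2 * (norm b)\<^sup>2"
  using norm_add_sq_le[of a "- b"] by simp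

text \<open>Subtracting the partial sums of \<open>b\<close> leaves a decreasing sequence that is
  bounded below. This deterministic form of the Robbins-Siegmund argument serves both along a
  trajectory and for expectations.\<close>

lemma quasi_decreasing_convergent:
  fixes f b g :: "nat \<Rightarrow> real"
  assumes step: "\<And>k. f (Suc k) + g k \<le> f k + b k"
    and g: "\<And>k. 0 \<le> g k" and b: "summable b" and lower: "\<And>k. m \<le> f k"
  shows "convergent f" "summable g"
proof -
  define S where "S n = (\<Sum>i<n. b i)" for n
  have S: "S \<longlonglongrightarrow> suminf b" unfolding S_def using b by (rule summable_LIMSEQ)
  then obtain K where K: "\<And>n. \<bar>S n\<bar> \<le> K"
    using convergent_imp_Bseq[OF convergentI[OF S]] unfolding Bseq_def by auto
  define F where "F n = f n - S n" for n
  have F: "F (Suc n) + g n \<le> F n" for n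
    using step[of n] by (simp add: F_def S_def)
  have dec: "decseq F" by (rule decseq_SucI) (use F g in \<open>smt (verit)\<close>)
  have low: "m - K \<le> F n" for n using lower[of n] K[of n] by (simp add: F_def abs_le_iff)
  obtain l where "F \<longlonglongrightarrow> l" using decseq_convergent[of F "m - K"] dec low by blast
  then have "(\<lambda>n. F n + S n) \<longlonglongrightarrow> l + suminf b" using S by (rule tendsto_add)
  then show "convergent f" by (auto simp: F_def convergent_def)
  have "(\<Sum>i<n. g i) \<le> F 0 - F n" for n
  proof (induction n)
    case (Suc n) then show ?case using F[of n] by simp
  qed simp
  then have "(\<Sum>i<n. g i) \<le> F 0 - (m - K)" for n using low[of n] by (smt (verit))
  then show "summable g" using g by (intro summableI_nonneg_bounded)
qed

lemma not_summable_inverse_shift: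
  fixes c :: real assumes "c > 0"
  shows "\<not> summable (\<lambda>k. 1 / (real k + c))"
proof
  assume s: "summable (\<lambda>k. 1 / (real k + c))"
  define m where "m = nat \<lceil>c\<rceil>"
  have m: "c \<le> real m" unfolding m_def by (rule of_nat_ceiling)
  have "summable (\<lambda>k. inverse (real (k + m)))"
    by (rule summable_comparison_test'[OF s, of 0]) (use m assms in \<open>auto simp: divide_simps\<close>)
  then show False using not_summable_harmonic[where ?'a = real]
    by (subst (asm) summable_iff_shift) auto
qed

text \<open>A positive limit would make the weighted series dominate a multiple of the divergent
  series of \<open>1 / (real k + c)\<close>.\<close>

lemma tendsto_zero_of_weighted_summable:
  fixes f :: "nat \<Rightarrow> real"
  assumes "convergent f" and nn: "\<And>k. 0 \<le> f k" and c: "c > 0"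
    and s: "summable (\<lambda>k. f k / (real k + c))"
  shows "f \<longlonglongrightarrow> 0"
proof -
  obtain l where l: "f \<longlonglongrightarrow> l" using assms(1) by (auto simp: convergent_def)
  have "l \<ge> 0" using l nn by (intro LIMSEQ_le_const[OF l]) auto
  moreover have "\<not> l > 0"
  proof
    assume "l > 0"
    then have "\<forall>\<^sub>F k in sequentially. f k > l / 2" by (intro order_tendstoD(1)[OF l]) simp
    then have "\<forall>\<^sub>F k in sequentially. norm (1 / (real k + c)) \<le> 2 / l * (f k / (real k + c))"
    proof eventually_elim
      case (elim k)
      then have "1 \<le> 2 / l * f k" using \<open>l > 0\<close> by (simp add: field_simps)
      from mult_right_mono[OF this, of "1 / (real k + c)"] show ?case using c by simp
    qed
    then have "summable (\<lambda>k. 1 / (real k + c))"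
      by (rule summable_comparison_test_ev) (intro summable_mult s)
    then show False using not_summable_inverse_shift[OF c] by simp
  qed
  ultimately show ?thesis using l by auto
qed

text \<open>Convexity of the squared norm at the combination of \<open>a\<close> and
  \<open>b / (1 - m)\<close> with weights \<open>m\<close> and \<open>1 - m\<close>. For
  \<open>m = 1 - s / t\<close> the perturbation \<open>b\<close> is charged with the factor t / s
  only.\<close>

lemma norm_sq_convex_le:
  fixes a b :: "'a::real_inner"
  assumes "0 \<le> m" "m < 1"
  shows "(norm (m *\<^sub>R a + b))\<^sup>2 \<le> m * (norm a)\<^sup>2 + (norm b)\<^sup>2 / (1 - m)"
proof (cases "m = 0")
  case False
  then have m: "m > 0" "1 - m > 0" using assms by auto
  have "(2 * m) * (a \<bullet> b) \<le> (m * (1 - m)) * (norm a)\<^sup>2 + (2 * m)\<^sup>2 / (4 * (m * (1 - m))) * (norm b)\<^sup>2"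
    using m by (intro inner_le_young) auto
  also have "(2 * m)\<^sup>2 / (4 * (m * (1 - m))) = 1 / (1 - m) - 1"
    using m by (simp add: field_simps power2_eq_square)
  finally have "2 * m * (a \<bullet> b) \<le> m * (1 - m) * (norm a)\<^sup>2 + (1 / (1 - m) - 1) * (norm b)\<^sup>2" .
  moreover have "(norm (m *\<^sub>R a + b))\<^sup>2 = m\<^sup>2 * (norm a)\<^sup>2 + 2 * m * (a \<bullet> b) + (norm b)\<^sup>2"
    unfolding power2_norm_eq_inner
    by (simp add: inner_add_left inner_add_right inner_commute power2_eq_square algebra_simps)
  ultimately show ?thesis by (simp add: power2_eq_square left_diff_distrib right_diff_distrib)
qed simp

lemma summable_nonneg_le:
  fixes f g :: "nat \<Rightarrow> real"
  assumes "summable g" "\<And>k. 0 \<le> f k" "\<And>k. f k \<le> g k"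
  shows "summable f"
  by (rule summable_comparison_test'[OF assms(1), of 0]) (use assms(2,3) in auto)

text \<open>By monotone convergence the sum of the series has finite expectation, so it is finite
  almost everywhere.\<close>

lemma AE_summable_of_summable_integral:
  fixes f :: "nat \<Rightarrow> 'a \<Rightarrow> real"
  assumes int: "\<And>k. integrable M (f k)" and nn: "\<And>k \<omega>. 0 \<le> f k \<omega>"
    and s: "summable (\<lambda>k. \<integral>\<omega>. f k \<omega> \<partial>M)"
  shows "AE \<omega> in M. summable (\<lambda>k. f k \<omega>)"
proof -
  have [measurable]: "f k \<in> borel_measurable M" for k using int by auto
  have "(\<integral>\<^sup>+\<omega>. (\<Sum>k. ennreal (f k \<omega>)) \<partial>M) = (\<Sum>k. \<integral>\<^sup>+\<omega>. ennreal (f k \<omega>) \<partial>M)"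
    by (rule nn_integral_suminf) measurable
  also have "\<dots> = (\<Sum>k. ennreal (\<integral>\<omega>. f k \<omega> \<partial>M))"
    by (intro suminf_cong nn_integral_eq_integral int) (use nn in auto)
  also have "\<dots> = ennreal (\<Sum>k. \<integral>\<omega>. f k \<omega> \<partial>M)"
    by (intro suminf_ennreal2 s integral_nonneg_AE) (use nn in auto)
  finally have "(\<integral>\<^sup>+\<omega>. (\<Sum>k. ennreal (f k \<omega>)) \<partial>M) \<noteq> \<infinity>" by simp
  then have "AE \<omega> in M. (\<Sum>k. ennreal (f k \<omega>)) \<noteq> \<infinity>"
    by (intro nn_integral_PInf_AE) measurable
  then show ?thesis
    by eventually_elim (auto intro: summable_suminf_not_top nn)
qed

text \<open>The error condition is available as an inequality of extended nonnegative integrals;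
  integrability of \<open>f\<close> is a conclusion here, which lets it propagate from one iteration
  to the next.\<close>

lemma integral_le_of_nn_integral_le:
  fixes f g :: "'a \<Rightarrow> real"
  assumes f: "f \<in> borel_measurable M" "\<And>\<omega>. 0 \<le> f \<omega>" and g: "integrable M g" "\<And>\<omega>. 0 \<le> g \<omega>"
    and le: "(\<integral>\<^sup>+\<omega>. ennreal (f \<omega>) \<partial>M) \<le> (\<integral>\<^sup>+\<omega>. ennreal (g \<omega>) \<partial>M)"
  shows "integrable M f" "(\<integral>\<omega>. f \<omega> \<partial>M) \<le> (\<integral>\<omega>. g \<omega> \<partial>M)"
proof -
  have ge: "(\<integral>\<^sup>+\<omega>. ennreal (g \<omega>) \<partial>M) = ennreal (\<integral>\<omega>. g \<omega> \<partial>M)"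
    using g by (intro nn_integral_eq_integral) auto
  show int: "integrable M f"
    using f le ge by (intro integrableI_nonneg) (auto simp: ennreal_less_top le_less_trans)
  have "(\<integral>\<^sup>+\<omega>. ennreal (f \<omega>) \<partial>M) = ennreal (\<integral>\<omega>. f \<omega> \<partial>M)"
    using f int by (intro nn_integral_eq_integral) auto
  with le ge show "(\<integral>\<omega>. f \<omega> \<partial>M) \<le> (\<integral>\<omega>. g \<omega> \<partial>M)"
    using g by (simp add: integral_nonneg_AE)
qed

section \<open>The Lyapunov function along a trajectory\<close>

locale vfog =
  fixes G :: "'a::euclidean_space \<Rightarrow> 'a" and T :: "'a \<Rightarrow> 'a set"
    and L \<rho> s \<eta> :: real and \<beta> \<gamma> :: "nat \<Rightarrow> real"
  assumes L_pos: "L > 0"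
    and lipschitz: "\<And>u u'. (norm (G u - G u'))\<^sup>2 \<le> L\<^sup>2 * (norm (u - u'))\<^sup>2"
    and rho_nonneg: "\<rho> \<ge> 0"
    and hypomonotone: "\<And>u wu u' wu'. (u, wu) \<in> gra_op G T \<Longrightarrow> (u', wu') \<in> gra_op G T \<Longrightarrow>
             inner (wu - wu') (u - u') \<ge> - \<rho> * (norm (wu - wu'))\<^sup>2"
    and s_gt: "s > 7"
    and eta_lower: "8 * (s - 1) * \<rho> \<le> (3 * s - 2) * \<eta>"
    and eta_rho: "(3 * s\<^sup>2 - 8 * s - 1) * \<eta> > 8 * (s - 1) * (s - 2) * \<rho>"
    and gamma_eq: "\<And>k. \<gamma> k = \<eta> * (real k + s) / ((s - 2) * (real k + s + 1))"
    and beta_eq: "\<And>k. \<beta> k = ((s - 2) * \<eta> / (4 * (s - 1)) + 2 * \<rho>) * (real k + 1) / (real k + s + 1)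
                          - \<gamma> k / (real k + s + 1)"
begin

text \<open>
  In the notation of the paper, \<open>tm k\<close> is the step counter with index k - 1, so that
  \<open>tm (Suc k)\<close> is the one used in iteration k. The sequences \<open>y\<close>, \<open>g\<close> below are shifted
  in the same way. The constant \<open>B\<close> is determined by
  \<open>tm (Suc k) * \<beta> k + \<gamma> k = B * (k + 1)\<close>, and \<open>c\<close> by \<open>c (Suc k) * \<gamma> k = s\<^sup>2 * (s - 1)\<close>.
\<close>

definition "h = (5 * s - 6) / (4 * (s - 1))"
text \<open>Half of \<open>B + \<eta>\<close>, the relation that makes the products of
  \<open>w (Suc k)\<close> with \<open>w k\<close> cancel in the energy balance. The surplus
  \<open>q - \<rho> = \<eta> * h / 2\<close> remains in front of the squared increment of
  \<open>w\<close>.\<close>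

definition "q = \<eta> * h / 2 + \<rho>"
definition "B = 2 * q - \<eta>"
definition "tm k = real k + s"
definition "a k = tm k * (\<eta> * tm k - q * real k)"
definition "C = s\<^sup>2 * (s - 1) * (s - 2) / \<eta>"
definition "c k = C * tm k / (tm k - 1)"
text \<open>The net loss of squared norm of \<open>w k\<close> in one step: it equals \<open>(k + 1)
  * (B * (k + 1) - \<gamma> k) + a k - (k + 1) * tm (Suc k) * q\<close>, in which the terms
  quadratic in k cancel.\<close>

definition "N k = 2 * (s - 1) * (real k + 1) * (\<eta> - q) + (s - 1)\<^sup>2 * \<eta> + (s - 1) * q - (real k + 1) * \<gamma> k"

section \<open>Estimates for the step-size constants\<close>

lemma eta_pos: "\<eta> > 0"
proof -
  have "3 * s\<^sup>2 - 8 * s - 1 = s * (3 * s - 8) - 1" by (simp add: power2_eq_square algebra_simps)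
  also have "\<dots> > 0" using s_gt mult_strict_mono[of 7 s 1 "3 * s - 8"] by simp
  finally have "3 * s\<^sup>2 - 8 * s - 1 > 0" .
  moreover have "0 \<le> 8 * (s - 1) * (s - 2) * \<rho>" using s_gt rho_nonneg by simp
  ultimately show ?thesis using eta_rho by (smt (verit) zero_less_mult_pos)
qed

lemma h_ge: "6/5 \<le> h"
  using s_gt by (simp add: h_def field_simps)

lemma tm_ge: "tm k > 7"
  using s_gt by (simp add: tm_def)

lemma tm_Suc: "tm (Suc k) = tm k + 1"
  by (simp add: tm_def)

lemma q_ge: "3/5 * \<eta> + \<rho> \<le> q"
  using mult_left_mono[OF h_ge, of \<eta>] eta_pos by (simp add: q_def)

lemma eta_q: "\<eta> - q = \<eta> * (3 * s - 2) / (8 * (s - 1)) - \<rho>"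
  using s_gt by (simp add: q_def h_def field_simps)

text \<open>This is \<open>eta_rho\<close> in another form, since (3s - 2)(s - 2) - 5 = 3s^2 - 8s -
  1. The margin is used twice: for the linear growth of \<open>N\<close> and for the positivity of
  the Lyapunov function.\<close>

lemma eta_q_gt: "\<eta> - q > 5 * \<eta> / (8 * (s - 1) * (s - 2))"
proof -
  have "8 * (s - 1) * (s - 2) * (\<eta> - q) = (3 * s - 2) * (s - 2) * \<eta> - 8 * (s - 1) * (s - 2) * \<rho>"
    using s_gt by (simp add: eta_q field_simps)
  also have "\<dots> > 5 * \<eta>" using eta_rho by (simp add: power2_eq_square algebra_simps)
  finally have "5 * \<eta> < (\<eta> - q) * (8 * (s - 1) * (s - 2))" by (simp add: mult.commute)
  moreover have "0 < 8 * (s - 1) * (s - 2)" using s_gt by simp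
  ultimately show ?thesis by (simp only: pos_divide_less_eq)
qed

lemma B_eq: "B = (s - 2) * \<eta> / (4 * (s - 1)) + 2 * \<rho>"
  using s_gt by (simp add: B_def q_def h_def field_simps)

lemma B_nonneg: "0 \<le> B"
  using s_gt eta_pos rho_nonneg by (simp add: B_eq)

lemma q_le: "q \<le> \<eta>"
  using eta_q_gt eta_pos s_gt by (smt (verit) divide_nonneg_nonneg mult_nonneg_nonneg)

lemma B_le: "B \<le> \<eta>"
  using q_le by (simp add: B_def)

lemma gamma_nonneg: "0 \<le> \<gamma> k"
  using s_gt eta_pos by (simp add: gamma_eq)

lemma gamma_le: "\<gamma> k \<le> \<eta> / (s - 2)"
proof -
  have "\<gamma> k = \<eta> / (s - 2) * ((real k + s) / (real k + s + 1))" by (simp add: gamma_eq)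
  also have "\<dots> \<le> \<eta> / (s - 2) * 1"
    using s_gt eta_pos by (intro mult_left_mono) auto
  finally show ?thesis by simp
qed

lemma beta_gamma: "tm (Suc k) * \<beta> k = B * (real k + 1) - \<gamma> k"
proof -
  have "real k + s + 1 \<noteq> 0" using s_gt by simp
  then have "(real k + s + 1) * \<beta> k = B * (real k + 1) - \<gamma> k"
    unfolding beta_eq B_eq[symmetric] by (simp add: right_diff_distrib)
  then show ?thesis by (simp add: tm_def add_ac)
qed

lemma C_pos: "C > 0" using s_gt eta_pos by (simp add: C_def)

lemma c_Suc_gamma: "c (Suc k) * \<gamma> k = s\<^sup>2 * (s - 1)"
  using s_gt eta_pos tm_ge[of k]
  by (simp add: c_def gamma_eq C_def tm_def divide_simps)

lemma c_ge: "c k \<ge> C"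
  using C_pos tm_ge[of k] by (simp add: c_def divide_simps)

lemma c_diff: "c k - c (Suc k) \<ge> C / (tm k)\<^sup>2"
proof -
  have t: "tm k > 1" using tm_ge[of k] by simp
  have "c k - c (Suc k) = C / (tm k * (tm k - 1))"
    using t by (simp add: c_def tm_Suc divide_simps) (simp add: algebra_simps)
  also have "\<dots> \<ge> C / (tm k)\<^sup>2"
    unfolding power2_eq_square using t C_pos by (intro divide_left_mono mult_left_mono mult_pos_pos) auto
  finally show ?thesis .
qed

lemma a_eq: "a k = (\<eta> - q) * (tm k)\<^sup>2 + q * s * tm k"
  by (simp add: a_def tm_def power2_eq_square algebra_simps)

text \<open>The subtracted terms are the later claims on \<open>N\<close>: Young's inequality for
  \<open>w k\<close> against \<open>d k\<close>, hypomonotonicity at a zero, and the squared step of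
  \<open>z\<close>. The term with s^2 / 3 on the right offsets the same multiple of the squared norm
  at the next index; the term growing with k gives summability. It survives because
  \<open>2 * (s - 1) * (\<eta> - q)\<close> exceeds \<open>5 * \<eta> / (4 * (s - 2))\<close> while
  \<open>\<gamma> k\<close> is at most \<open>\<eta> / (s - 2)\<close>.\<close>

lemma N_lower: "N k - \<eta> / (s - 2)\<^sup>2 - s * (s - 1) * \<rho> - (s - 1) * \<eta> / (s - 2)
    \<ge> \<eta> * s\<^sup>2 / 3 + \<eta> * (real k + 1) / (4 * (s - 2))"
proof -
  have "5 * \<eta> / (4 * (s - 2)) \<le> 2 * (s - 1) * (\<eta> - q)"
  proof -
    have "2 * (s - 1) * (5 * \<eta> / (8 * (s - 1) * (s - 2))) \<le> 2 * (s - 1) * (\<eta> - q)"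
      using eta_q_gt s_gt by (intro mult_left_mono) auto
    moreover have "2 * (s - 1) * (5 * \<eta> / (8 * (s - 1) * (s - 2))) = 5 * \<eta> / (4 * (s - 2))"
      using s_gt by (simp add: divide_simps) (simp add: algebra_simps)
    ultimately show ?thesis by simp
  qed
  then have "5 * \<eta> / (4 * (s - 2)) - \<eta> / (s - 2) \<le> 2 * (s - 1) * (\<eta> - q) - \<gamma> k"
    using gamma_le[of k] by linarith
  moreover have "5 * \<eta> / (4 * (s - 2)) - \<eta> / (s - 2) = \<eta> / (4 * (s - 2))"
    using s_gt by (simp add: divide_simps)
  ultimately have "\<eta> / (4 * (s - 2)) \<le> 2 * (s - 1) * (\<eta> - q) - \<gamma> k" by simp
  then have 1: "(real k + 1) * (\<eta> / (4 * (s - 2))) \<le> (real k + 1) * (2 * (s - 1) * (\<eta> - q) - \<gamma> k)"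
    by (intro mult_left_mono) auto
  have q1: "(s - 1) * q \<ge> (s - 1) * (3/5 * \<eta> + \<rho>)"
    using q_ge s_gt by (intro mult_left_mono) auto
  have r1: "(s - 1) * (8 * (s - 1) * \<rho>) \<le> (s - 1) * ((3 * s - 2) * \<eta>)"
    using eta_lower s_gt by (intro mult_left_mono) auto
  have e1: "\<eta> / (s - 2)\<^sup>2 \<le> \<eta>"
    using s_gt eta_pos by (simp add: field_simps)
  have e2: "(s - 1) * \<eta> / (s - 2) \<le> 2 * \<eta>"
    using s_gt eta_pos by (simp add: field_simps)
  \<comment> \<open>The summand with 3s - 2 bounds the net cost (s - 1)^2 \<rho> through
    \<open>eta_lower\<close>; the 3 collects \<open>e1\<close> and \<open>e2\<close>.\<close>
  have poly: "\<eta> * ((s - 1)\<^sup>2 + 3/5 * (s - 1) - (s - 1) * (3 * s - 2) / 8 - 3 - s\<^sup>2 / 3) \<ge> 0"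
  proof (rule mult_nonneg_nonneg)
    have "s * s \<ge> s * 7" using s_gt by (intro mult_left_mono) auto
    moreover have "(s - 1)\<^sup>2 + 3/5 * (s - 1) - (s - 1) * (3 * s - 2) / 8 - 3 - s\<^sup>2 / 3
        = 7/24 * (s * s) - 31/40 * s - 57/20"
      by (simp add: power2_eq_square field_simps)
    ultimately show "0 \<le> (s - 1)\<^sup>2 + 3/5 * (s - 1) - (s - 1) * (3 * s - 2) / 8 - 3 - s\<^sup>2 / 3"
      using s_gt by linarith
  qed (use eta_pos in simp)
  have "(s - 1)\<^sup>2 * \<eta> + (s - 1) * q - s * (s - 1) * \<rho> - \<eta> / (s - 2)\<^sup>2 - (s - 1) * \<eta> / (s - 2) \<ge> \<eta> * s\<^sup>2 / 3"
    using q1 r1 e1 e2 poly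
    by (simp add: power2_eq_square algebra_simps add_divide_distrib diff_divide_distrib)
  with 1 show ?thesis by (simp add: N_def algebra_simps)
qed

end

section \<open>One-step energy estimates along a trajectory\<close>

locale vfog_path = vfog G T L \<rho> s \<eta> \<beta> \<gamma>
  for G :: "'a::euclidean_space \<Rightarrow> 'a" and T L \<rho> s \<eta> \<beta> \<gamma> +
  fixes x v z y g :: "nat \<Rightarrow> 'a"
  assumes graph: "v k \<in> T (x k)"
    and y_Suc: "y (Suc k) = ((real k + 1) / (real k + s + 1)) *\<^sub>R x k + (s / (real k + s + 1)) *\<^sub>R z k
        - (\<eta> - \<beta> k) *\<^sub>R (g k + v k)"
    and x_Suc: "x (Suc k) = ((real k + 1) / (real k + s + 1)) *\<^sub>R x k + (s / (real k + s + 1)) *\<^sub>R z k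
        - \<eta> *\<^sub>R (g (Suc k) + v (Suc k)) + \<beta> k *\<^sub>R (g k + v k)"
    and z_Suc: "z (Suc k) = z k - (\<gamma> k / s) *\<^sub>R (g k + v k)"
begin

definition "w k = G (x k) + v k"
definition "u k = g k + v k"
definition "d k = w k - u k"
definition "p k = L\<^sup>2 * (norm (x k - y k))\<^sup>2"
definition "e2 k = (norm (g k - G (y k)))\<^sup>2"
definition "E k = s * tm k * (w k \<bullet> (x k - z k)) + a k * (norm (w k))\<^sup>2"

lemma graph_w: "(x k, w k) \<in> gra_op G T"
  using graph by (auto simp: gra_op_def w_def)

text \<open>Both points start from the same extrapolated point and the \<beta>-terms cancel. Hence
  the squared increment of \<open>u\<close>, which the descent provides with a negative sign,
  controls the distance between \<open>x\<close> and \<open>y\<close>.\<close>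

lemma x_y_Suc: "x (Suc k) - y (Suc k) = - \<eta> *\<^sub>R (u (Suc k) - u k)"
  by (simp add: x_Suc y_Suc u_def algebra_simps)

lemma p_Suc: "p (Suc k) = L\<^sup>2 * \<eta>\<^sup>2 * (norm (u (Suc k) - u k))\<^sup>2"
  by (simp add: p_def x_y_Suc power_mult_distrib)

lemma p_nonneg: "0 \<le> p k"
  by (simp add: p_def)

lemma d_le: "(norm (d k))\<^sup>2 \<le> 2 * p k + 2 * e2 k"
proof -
  have "d k = (G (x k) - G (y k)) - (g k - G (y k))" by (simp add: d_def w_def u_def)
  then have "(norm (d k))\<^sup>2 \<le> 2 * (norm (G (x k) - G (y k)))\<^sup>2 + 2 * e2 k"
    using norm_diff_sq_le[of "G (x k) - G (y k)" "g k - G (y k)"] by (simp add: e2_def)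
  with lipschitz[of "x k" "y k"] show ?thesis by (simp add: p_def)
qed

lemma x_diff: "tm (Suc k) *\<^sub>R (x (Suc k) - x k) =
    - s *\<^sub>R (x k - z k) - (\<eta> * tm (Suc k)) *\<^sub>R u (Suc k) + (B * (real k + 1) - \<gamma> k) *\<^sub>R u k"
proof -
  have t: "real k + s + 1 = tm (Suc k)" "real k + 1 = tm (Suc k) - s" by (simp_all add: tm_def)
  have nz: "tm (Suc k) \<noteq> 0" using tm_ge[of "Suc k"] by simp
  have "tm (Suc k) *\<^sub>R x (Suc k) = (tm (Suc k) - s) *\<^sub>R x k + s *\<^sub>R z k
       - (tm (Suc k) * \<eta>) *\<^sub>R u (Suc k) + (tm (Suc k) * \<beta> k) *\<^sub>R u k"
    using nz unfolding x_Suc t by (simp add: scaleR_add_right scaleR_diff_right u_def)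
  then show ?thesis unfolding beta_gamma by (simp add: algebra_simps)
qed

text \<open>The same increment as in \<open>x_diff\<close>, written around the new pair, which
  removes \<open>\<gamma> k\<close>. Pairing \<open>x_diff\<close> with \<open>w k\<close> and this
  one with \<open>w (Suc k)\<close> produces the inner products in \<open>E k\<close> and
  \<open>E (Suc k)\<close>.\<close>

lemma x_diff': "(real k + 1) *\<^sub>R (x (Suc k) - x k) =
    - s *\<^sub>R (x (Suc k) - z (Suc k)) - (\<eta> * tm (Suc k)) *\<^sub>R u (Suc k) + (B * (real k + 1)) *\<^sub>R u k"
proof -
  have z: "s *\<^sub>R z (Suc k) = s *\<^sub>R z k - \<gamma> k *\<^sub>R u k"
    using s_gt by (simp add: z_Suc u_def scaleR_diff_right)
  have "(real k + 1) *\<^sub>R (x (Suc k) - x k) = tm (Suc k) *\<^sub>R (x (Suc k) - x k) - s *\<^sub>R (x (Suc k) - x k)"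
    by (simp add: tm_def algebra_simps)
  also have "\<dots> = - s *\<^sub>R (x (Suc k)) + s *\<^sub>R z (Suc k) - (\<eta> * tm (Suc k)) *\<^sub>R u (Suc k) + (B * (real k + 1)) *\<^sub>R u k"
    unfolding x_diff z by (simp add: algebra_simps)
  finally show ?thesis by (simp add: algebra_simps)
qed

text \<open>Hypomonotonicity between consecutive iterates, multiplied by
  \<open>(k + 1) * tm (Suc k)\<close> to match the factors of \<open>x_diff'\<close> and
  \<open>x_diff\<close>, is the only inequality used; all products with \<open>d\<close> are
  kept.\<close>

lemma E_step_exact:
  "E (Suc k) \<le> E k - s * (s - 1) * (w k \<bullet> (x k - z k)) - N k * (norm (w k))\<^sup>2
     - tm (Suc k) * (real k + 1) * \<eta> * (h / 2) * (norm (w (Suc k) - w k))\<^sup>2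
     - B * (real k + 1) * tm (Suc k) * (w (Suc k) \<bullet> d k) + \<eta> * (tm (Suc k))\<^sup>2 * (w (Suc k) \<bullet> d (Suc k))
     - (real k + 1) * tm (Suc k) * \<eta> * (w k \<bullet> d (Suc k))
     + (real k + 1) * (B * (real k + 1) - \<gamma> k) * (w k \<bullet> d k)"
proof -
  define r where "r = real k + 1"
  define \<tau> where "\<tau> = tm (Suc k)"
  have tm: "tm k = r + s - 1" "\<tau> = r + s" "real k = r - 1" "real (Suc k) = r"
    by (simp_all add: tm_def r_def \<tau>_def)
  have pos: "r > 0" "\<tau> > 0" using s_gt by (simp_all add: r_def tm(2))
  define X where "X = x (Suc k) - x k"
  have mono: "(w (Suc k) - w k) \<bullet> X \<ge> - \<rho> * (norm (w (Suc k) - w k))\<^sup>2"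
    unfolding X_def using hypomonotone[OF graph_w graph_w] .
  have I1: "r * (w (Suc k) \<bullet> X) = - s * (w (Suc k) \<bullet> (x (Suc k) - z (Suc k)))
      - \<eta> * \<tau> * (w (Suc k) \<bullet> u (Suc k)) + B * r * (w (Suc k) \<bullet> u k)"
    using arg_cong[OF x_diff'[of k], of "\<lambda>X. w (Suc k) \<bullet> X"]
    unfolding r_def[symmetric] \<tau>_def[symmetric] X_def[symmetric]
    by (simp only: inner_add_right inner_diff_right inner_scaleR_right inner_minus_right)
  have I2: "\<tau> * (w k \<bullet> X) = - s * (w k \<bullet> (x k - z k))
      - \<eta> * \<tau> * (w k \<bullet> u (Suc k)) + (B * r - \<gamma> k) * (w k \<bullet> u k)"
    using arg_cong[OF x_diff[of k], of "\<lambda>X. w k \<bullet> X"]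
    unfolding r_def[symmetric] \<tau>_def[symmetric] X_def[symmetric]
    by (simp only: inner_add_right inner_diff_right inner_scaleR_right inner_minus_right)
  define ww where "ww = w (Suc k) \<bullet> w k"
  define n n' where "n = (norm (w k))\<^sup>2" and "n' = (norm (w (Suc k)))\<^sup>2"
  have dw: "(norm (w (Suc k) - w k))\<^sup>2 = n' - 2 * ww + n"
    by (simp add: n_def n'_def ww_def power2_norm_eq_inner inner_simps inner_commute)
  have us: "w (Suc k) \<bullet> u (Suc k) = n' - w (Suc k) \<bullet> d (Suc k)" "w k \<bullet> u k = n - w k \<bullet> d k"
     "w (Suc k) \<bullet> u k = ww - w (Suc k) \<bullet> d k" "w k \<bullet> u (Suc k) = ww - w k \<bullet> d (Suc k)"
    by (simp_all add: n_def n'_def ww_def d_def power2_norm_eq_inner inner_simps inner_commute)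
  define D D' where "D = w k \<bullet> (x k - z k)" and "D' = w (Suc k) \<bullet> (x (Suc k) - z (Suc k))"
  define X' X0 where "X' = w (Suc k) \<bullet> X" and "X0 = w k \<bullet> X"
  have M: "0 \<le> r * \<tau> * (X' - X0 + \<rho> * (n' - 2 * ww + n))"
    using mono pos unfolding dw by (intro mult_nonneg_nonneg) (auto simp: inner_diff_left X'_def X0_def)
  define a1 a2 a3 a4 where "a1 = w (Suc k) \<bullet> d (Suc k)" and "a2 = w k \<bullet> d k"
    and "a3 = w (Suc k) \<bullet> d k" and "a4 = w k \<bullet> d (Suc k)"
  note defs = D_def[symmetric] D'_def[symmetric] X'_def[symmetric] X0_def[symmetric]
    n_def[symmetric] n'_def[symmetric] a1_def[symmetric] a2_def[symmetric] a3_def[symmetric] a4_def[symmetric]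
    r_def[symmetric] \<tau>_def[symmetric]
  have J1: "s * \<tau> * D' = - \<tau> * (r * X') - \<eta> * \<tau>\<^sup>2 * (n' - a1) + B * r * \<tau> * (ww - a3)"
    unfolding I1[unfolded us defs] by (simp add: algebra_simps power2_eq_square)
  have J2: "s * r * D = - r * (\<tau> * X0) - \<eta> * \<tau> * r * (ww - a4) + r * (B * r - \<gamma> k) * (n - a2)"
    unfolding I2[unfolded us defs] by (simp add: algebra_simps)
  have \<eta>h: "\<eta> * (h / 2) = q - \<rho>" by (simp add: q_def)
  have "s * \<tau> * D' + a (Suc k) * n' \<le> s * tm k * D + a k * n - s * (s - 1) * D - N k * n
     - \<tau> * r * (\<eta> * (h / 2)) * (n' - 2 * ww + n)
     - B * r * \<tau> * a3 + \<eta> * \<tau>\<^sup>2 * a1 - r * \<tau> * \<eta> * a4 + r * (B * r - \<gamma> k) * a2"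
  proof -
    have "s * tm k * D - s * (s - 1) * D = s * r * D" by (simp add: tm algebra_simps)
    \<comment> \<open>This identity fixes the coefficients: \<open>B\<close> by comparing
      \<open>ww\<close>, \<open>a (Suc k)\<close> by comparing \<open>n'\<close>, and
      \<open>N k\<close> by comparing \<open>n\<close>.\<close>
    moreover have "- \<tau> * (r * X') - \<eta> * \<tau>\<^sup>2 * (n' - a1) + B * r * \<tau> * (ww - a3)
       + a (Suc k) * n' + r * \<tau> * (X' - X0 + \<rho> * (n' - 2 * ww + n))
       = - r * (\<tau> * X0) - \<eta> * \<tau> * r * (ww - a4) + r * (B * r - \<gamma> k) * (n - a2) + a k * n - N k * n
     - \<tau> * r * (\<eta> * (h / 2)) * (n' - 2 * ww + n)
     - B * r * \<tau> * a3 + \<eta> * \<tau>\<^sup>2 * a1 - r * \<tau> * \<eta> * a4 + r * (B * r - \<gamma> k) * a2"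
      unfolding \<eta>h a_def N_def defs tm B_def
      by (simp add: algebra_simps power2_eq_square)
    ultimately show ?thesis using M J1 J2 by linarith
  qed
  then show ?thesis unfolding E_def dw defs by (simp add: mult.assoc)
qed

lemma E_step:
  "E (Suc k) + \<eta> / 4 * (real k + 1) * tm (Suc k) * (norm (u (Suc k) - u k))\<^sup>2
   \<le> E k - s * (s - 1) * (w k \<bullet> (x k - z k)) - (N k - \<eta> / (s - 2)\<^sup>2) * (norm (w k))\<^sup>2
     + \<eta> * s\<^sup>2 / 3 * (norm (w (Suc k)))\<^sup>2
     + 5/2 * \<eta> * (tm (Suc k))\<^sup>2 * (norm (d (Suc k)))\<^sup>2 + 11/4 * \<eta> * (tm k)\<^sup>2 * (norm (d k))\<^sup>2"
proof -
  define r where "r = real k + 1"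
  define \<tau> where "\<tau> = tm (Suc k)"
  have tm: "tm k = r + s - 1" "\<tau> = r + s"
    by (simp_all add: tm_def r_def \<tau>_def)
  have r: "r \<ge> 1" by (simp add: r_def)
  have \<tau>: "\<tau> > 0" using s_gt r by (simp add: tm(2))
  define W where "W = w (Suc k) - w k"
  have Du: "u (Suc k) - u k = W - d (Suc k) + d k" by (simp add: W_def d_def)
  \<comment> \<open>The ratio of the weights of the products of \<open>W\<close> with
    \<open>d k\<close> and with \<open>d (Suc k)\<close>; it lies in [0,1] because
    \<open>B \<le> \<eta>\<close> and \<open>r \<le> \<tau>\<close>.\<close>
  define b where "b = B * r / (\<tau> * \<eta>)"
  have b: "0 \<le> b" "b \<le> 1"
  proof -
    show "0 \<le> b" using B_nonneg r \<tau> eta_pos by (simp add: b_def)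
    have "B * r \<le> \<eta> * \<tau>" using B_le B_nonneg r s_gt tm(2) eta_pos by (intro mult_mono) auto
    then show "b \<le> 1" using \<tau> eta_pos by (simp add: b_def mult.commute)
  qed
  have b_mult: "r * \<tau> * \<eta> * b = B * r\<^sup>2"
    using \<tau> eta_pos by (simp add: b_def power2_eq_square)
  have m1: "r * \<tau> * \<eta> * (W \<bullet> d (Suc k) - b * (W \<bullet> d k) + (norm (W - d (Suc k) + d k))\<^sup>2 / 4)
     \<le> r * \<tau> * \<eta> * (h / 2 * (norm W)\<^sup>2 + (norm (d k))\<^sup>2 + (norm (d (Suc k)))\<^sup>2)"
    using b h_ge r \<tau> eta_pos by (intro mult_left_mono cross_terms_le) auto
  have m2: "r * \<tau> * \<eta> * (W \<bullet> d (Suc k) - b * (W \<bullet> d k) + (norm (W - d (Suc k) + d k))\<^sup>2 / 4)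
     = r * \<tau> * \<eta> * (W \<bullet> d (Suc k)) - B * r\<^sup>2 * (W \<bullet> d k) + \<eta> / 4 * r * \<tau> * (norm (W - d (Suc k) + d k))\<^sup>2"
    unfolding b_mult[symmetric] by (simp add: algebra_simps)
  have 1: "r * \<tau> * \<eta> * (W \<bullet> d (Suc k)) - B * r\<^sup>2 * (W \<bullet> d k) + \<eta> / 4 * r * \<tau> * (norm (u (Suc k) - u k))\<^sup>2
     \<le> r * \<tau> * \<eta> * (h / 2) * (norm W)\<^sup>2 + r * \<tau> * \<eta> * (norm (d k))\<^sup>2 + r * \<tau> * \<eta> * (norm (d (Suc k)))\<^sup>2"
    using m1 unfolding m2 unfolding Du[symmetric] by (simp add: distrib_left mult.assoc)
  have "\<eta> * ((\<tau> * s) * (w (Suc k) \<bullet> d (Suc k)))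
     \<le> \<eta> * (s\<^sup>2 / 6 * (norm (w (Suc k)))\<^sup>2 + (\<tau> * s)\<^sup>2 / (4 * (s\<^sup>2 / 6)) * (norm (d (Suc k)))\<^sup>2)"
    using s_gt eta_pos by (intro mult_left_mono inner_le_young) auto
  also have "(\<tau> * s)\<^sup>2 / (4 * (s\<^sup>2 / 6)) = 3/2 * \<tau>\<^sup>2"
    using s_gt by (simp add: power_mult_distrib)
  finally have 2: "\<eta> * \<tau> * s * (w (Suc k) \<bullet> d (Suc k))
     \<le> \<eta> * s\<^sup>2 / 6 * (norm (w (Suc k)))\<^sup>2 + 3/2 * \<eta> * \<tau>\<^sup>2 * (norm (d (Suc k)))\<^sup>2"
    by (simp add: algebra_simps)
  have "(- B * r * s) * (w (Suc k) \<bullet> d k) \<le> \<eta> * s\<^sup>2 / 6 * (norm (w (Suc k)))\<^sup>2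
      + (- B * r * s)\<^sup>2 / (4 * (\<eta> * s\<^sup>2 / 6)) * (norm (d k))\<^sup>2"
    using s_gt eta_pos by (intro inner_le_young) auto
  also have "(- B * r * s)\<^sup>2 / (4 * (\<eta> * s\<^sup>2 / 6)) = 3/2 * r\<^sup>2 * (B\<^sup>2 / \<eta>)"
    using s_gt eta_pos by (simp add: power_mult_distrib)
  also have "3/2 * r\<^sup>2 * (B\<^sup>2 / \<eta>) * (norm (d k))\<^sup>2 \<le> 3/2 * r\<^sup>2 * \<eta> * (norm (d k))\<^sup>2"
  proof (intro mult_right_mono mult_left_mono)
    have "B\<^sup>2 \<le> \<eta>\<^sup>2" using B_le B_nonneg by (intro power_mono) auto
    then show "B\<^sup>2 / \<eta> \<le> \<eta>" using eta_pos by (simp add: field_simps power2_eq_square)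
  qed auto
  finally have 3: "- (B * r * s * (w (Suc k) \<bullet> d k)) \<le> \<eta> * s\<^sup>2 / 6 * (norm (w (Suc k)))\<^sup>2
      + 3/2 * r\<^sup>2 * \<eta> * (norm (d k))\<^sup>2"
    by simp
  have "(- r * \<gamma> k) * (w k \<bullet> d k) \<le> \<eta> / (s - 2)\<^sup>2 * (norm (w k))\<^sup>2
      + (- r * \<gamma> k)\<^sup>2 / (4 * (\<eta> / (s - 2)\<^sup>2)) * (norm (d k))\<^sup>2"
    using s_gt eta_pos by (intro inner_le_young) auto
  also have "(- r * \<gamma> k)\<^sup>2 / (4 * (\<eta> / (s - 2)\<^sup>2)) = r\<^sup>2 / 4 * ((\<gamma> k * (s - 2))\<^sup>2 / \<eta>)"
    by (simp add: power_mult_distrib)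
  also have "r\<^sup>2 / 4 * ((\<gamma> k * (s - 2))\<^sup>2 / \<eta>) * (norm (d k))\<^sup>2 \<le> r\<^sup>2 / 4 * \<eta> * (norm (d k))\<^sup>2"
  proof (intro mult_right_mono mult_left_mono)
    have "\<gamma> k * (s - 2) \<le> \<eta>" using gamma_le[of k] s_gt by (simp add: field_simps)
    then have "(\<gamma> k * (s - 2))\<^sup>2 \<le> \<eta>\<^sup>2" using gamma_nonneg[of k] s_gt by (intro power_mono) auto
    then show "(\<gamma> k * (s - 2))\<^sup>2 / \<eta> \<le> \<eta>" using eta_pos by (simp add: field_simps power2_eq_square)
  qed auto
  finally have 4: "- (r * \<gamma> k * (w k \<bullet> d k)) \<le> \<eta> / (s - 2)\<^sup>2 * (norm (w k))\<^sup>2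
      + r\<^sup>2 / 4 * \<eta> * (norm (d k))\<^sup>2"
    by simp
  have Wd: "W \<bullet> d (Suc k) = w (Suc k) \<bullet> d (Suc k) - w k \<bullet> d (Suc k)"
      "W \<bullet> d k = w (Suc k) \<bullet> d k - w k \<bullet> d k"
    by (simp_all add: W_def inner_diff_left)
  \<comment> \<open>Writing \<open>\<tau> = r + s\<close> isolates the increment \<open>W\<close> in
    all terms of order k^2. What is left is only linear in k, so Young's inequality charges bounded
    multiples of the squared norm of \<open>w\<close> against k^2 times that of
    \<open>d\<close>.\<close>
  have split: "- B * r * \<tau> * (w (Suc k) \<bullet> d k) + \<eta> * \<tau>\<^sup>2 * (w (Suc k) \<bullet> d (Suc k))
     - r * \<tau> * \<eta> * (w k \<bullet> d (Suc k)) + r * (B * r - \<gamma> k) * (w k \<bullet> d k)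
     = (r * \<tau> * \<eta> * (W \<bullet> d (Suc k)) - B * r\<^sup>2 * (W \<bullet> d k)) + \<eta> * \<tau> * s * (w (Suc k) \<bullet> d (Suc k))
      - B * r * s * (w (Suc k) \<bullet> d k) - r * \<gamma> k * (w k \<bullet> d k)"
    unfolding Wd tm(2) by (simp add: power2_eq_square algebra_simps)
  have t1: "r * \<tau> * \<eta> * (norm (d (Suc k)))\<^sup>2 \<le> \<tau> * \<tau> * \<eta> * (norm (d (Suc k)))\<^sup>2"
    using tm(2) s_gt \<tau> eta_pos by (intro mult_right_mono) auto
  have "r * \<tau> \<le> (tm k)\<^sup>2"
  proof -
    have "(tm k)\<^sup>2 - r * \<tau> = (s - 2) * r + (s - 1)\<^sup>2" by (simp add: tm power2_eq_square algebra_simps)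
    then show ?thesis using s_gt r by (smt (verit) mult_nonneg_nonneg zero_le_power2)
  qed
  then have t2: "r * \<tau> * \<eta> * (norm (d k))\<^sup>2 \<le> (tm k)\<^sup>2 * \<eta> * (norm (d k))\<^sup>2"
    using eta_pos by (intro mult_right_mono) auto
  have "r\<^sup>2 \<le> (tm k)\<^sup>2" using tm s_gt r by (intro power_mono) auto
  then have t3: "r\<^sup>2 * \<eta> * (norm (d k))\<^sup>2 \<le> (tm k)\<^sup>2 * \<eta> * (norm (d k))\<^sup>2"
    using eta_pos by (intro mult_right_mono) auto
  have "E (Suc k) \<le> E k - s * (s - 1) * (w k \<bullet> (x k - z k)) - N k * (norm (w k))\<^sup>2
     - r * \<tau> * \<eta> * (h / 2) * (norm W)\<^sup>2
     + (- B * r * \<tau> * (w (Suc k) \<bullet> d k) + \<eta> * \<tau>\<^sup>2 * (w (Suc k) \<bullet> d (Suc k))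
     - r * \<tau> * \<eta> * (w k \<bullet> d (Suc k)) + r * (B * r - \<gamma> k) * (w k \<bullet> d k))"
    using E_step_exact[of k] unfolding r_def[symmetric] \<tau>_def[symmetric] W_def[symmetric] by (simp add: mult_ac)
  moreover define \<epsilon> where "\<epsilon> = \<eta> / (s - 2)\<^sup>2"
  ultimately show ?thesis
    using 1 2 3 4 t1 t2 t3
    unfolding split r_def[symmetric] \<tau>_def[symmetric] \<epsilon>_def[symmetric]
    by (simp add: power2_eq_square algebra_simps)
qed

definition "V xs k = E k + c k / 2 * (norm (z k - xs))\<^sup>2"
text \<open>The shift moves the term with s^2 / 3 and \<open>w (Suc k)\<close>, which
  \<open>V_step\<close> leaves on the right, into the potential, where it telescopes.\<close>

definition "Vb xs k = V xs k - \<eta> * s\<^sup>2 / 3 * (norm (w k))\<^sup>2"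

lemma w_zero_inner:
  assumes "xs \<in> zer_op G T"
  shows "w k \<bullet> (x k - xs) \<ge> - \<rho> * (norm (w k))\<^sup>2"
proof -
  have "(xs, 0) \<in> gra_op G T" using assms by (auto simp: zer_op_def gra_op_def)
  from hypomonotone[OF graph_w this, of k] show ?thesis by simp
qed

lemma V_step:
  assumes xs: "xs \<in> zer_op G T"
  shows "V xs (Suc k) + \<eta> / 4 * (real k + 1) * tm (Suc k) * (norm (u (Suc k) - u k))\<^sup>2
        + \<eta> * (real k + 1) / (4 * (s - 2)) * (norm (w k))\<^sup>2
      \<le> V xs k + \<eta> * s\<^sup>2 / 3 * (norm (w (Suc k)))\<^sup>2 - \<eta> * s\<^sup>2 / 3 * (norm (w k))\<^sup>2
       + 5/2 * \<eta> * (tm (Suc k))\<^sup>2 * (norm (d (Suc k)))\<^sup>2 + 7/2 * \<eta> * (tm k)\<^sup>2 * (norm (d k))\<^sup>2"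
proof -
  define \<Delta> where "\<Delta> = (norm (d k))\<^sup>2"
  define n where "n = (norm (w k))\<^sup>2"
  have nn: "0 \<le> \<Delta>" "0 \<le> n" by (simp_all add: \<Delta>_def n_def)
  have zS: "z (Suc k) - xs = (z k - xs) - (\<gamma> k / s) *\<^sub>R u k" by (simp add: z_Suc u_def)
  have zN: "(norm (z (Suc k) - xs))\<^sup>2 = (norm (z k - xs))\<^sup>2 - 2 * (\<gamma> k / s) * (u k \<bullet> (z k - xs)) + (\<gamma> k / s)\<^sup>2 * (norm (u k))\<^sup>2"
    unfolding zS power2_norm_eq_inner inner_diff_left inner_diff_right inner_scaleR_left inner_scaleR_right
    by (simp add: inner_commute power2_eq_square algebra_simps)
  have "c (Suc k) / 2 * (norm (z (Suc k) - xs))\<^sup>2 = c (Suc k) / 2 * (norm (z k - xs))\<^sup>2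
     - (c (Suc k) * \<gamma> k) / s * (u k \<bullet> (z k - xs)) + (c (Suc k) * \<gamma> k) * \<gamma> k / (2 * s\<^sup>2) * (norm (u k))\<^sup>2"
    unfolding zN using s_gt by (simp add: power2_eq_square algebra_simps)
  then have z: "c (Suc k) / 2 * (norm (z (Suc k) - xs))\<^sup>2 = c (Suc k) / 2 * (norm (z k - xs))\<^sup>2
     - s * (s - 1) * (u k \<bullet> (z k - xs)) + (s - 1) * \<gamma> k / 2 * (norm (u k))\<^sup>2"
    unfolding c_Suc_gamma using s_gt by (simp add: power2_eq_square)
  have "(norm (u k))\<^sup>2 \<le> 2 * n + 2 * \<Delta>"
    using norm_diff_sq_le[of "w k" "d k"] by (simp add: d_def \<Delta>_def n_def)
  then have "(s - 1) * \<gamma> k / 2 * (norm (u k))\<^sup>2 \<le> (s - 1) * (\<eta> / (s - 2)) / 2 * (2 * n + 2 * \<Delta>)"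
    using s_gt gamma_le[of k] gamma_nonneg[of k] eta_pos
    by (intro mult_mono divide_right_mono mult_left_mono) auto
  also have "\<dots> = (s - 1) * \<eta> / (s - 2) * n + (s - 1) * \<eta> / (s - 2) * \<Delta>"
    using s_gt by (simp add: divide_simps) (simp add: algebra_simps)
  finally have u: "(s - 1) * \<gamma> k / 2 * (norm (u k))\<^sup>2 \<le> (s - 1) * \<eta> / (s - 2) * n + (s - 1) * \<eta> / (s - 2) * \<Delta>" .
  have tk: "tm k > 0" using tm_ge[of k] by simp
  have "s * (s - 1) * ((z k - xs) \<bullet> d k) \<le> (C / (tm k)\<^sup>2 / 2) * (norm (z k - xs))\<^sup>2
     + (s * (s - 1))\<^sup>2 / (4 * (C / (tm k)\<^sup>2 / 2)) * \<Delta>"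
    unfolding \<Delta>_def using C_pos tk by (intro inner_le_young) auto
  also have "(s * (s - 1))\<^sup>2 / (4 * (C / (tm k)\<^sup>2 / 2)) = (s - 1) * \<eta> / (2 * (s - 2)) * (tm k)\<^sup>2"
    using s_gt tk eta_pos by (simp add: C_def power2_eq_square divide_simps)
  also have "(C / (tm k)\<^sup>2 / 2) * (norm (z k - xs))\<^sup>2 \<le> (c k - c (Suc k)) / 2 * (norm (z k - xs))\<^sup>2"
    using c_diff[of k] by (intro mult_right_mono divide_right_mono) auto
  finally have dz: "s * (s - 1) * (d k \<bullet> (z k - xs)) \<le> (c k - c (Suc k)) / 2 * (norm (z k - xs))\<^sup>2
     + (s - 1) * \<eta> / (2 * (s - 2)) * (tm k)\<^sup>2 * \<Delta>"
    by (simp add: inner_commute)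
  have "s * (s - 1) * (w k \<bullet> (x k - xs)) \<ge> s * (s - 1) * (- \<rho> * n)"
    using s_gt w_zero_inner[OF xs, of k] unfolding n_def by (intro mult_left_mono) auto
  then have m: "s * (s - 1) * (w k \<bullet> (x k - xs)) \<ge> - s * (s - 1) * \<rho> * n" by simp
  \<comment> \<open>The \<open>z\<close>-update contributes the same factor
    \<open>s * (s - 1)\<close> as \<open>E_step\<close>; this is the reason for the value in
    \<open>c_Suc_gamma\<close>. So \<open>z k\<close> drops out of the product with
    \<open>w k\<close>, and hypomonotonicity applies to the remaining difference
    \<open>x k - xs\<close>.\<close>
  have inn: "- s * (s - 1) * (w k \<bullet> (x k - z k)) - s * (s - 1) * (u k \<bullet> (z k - xs))
     = - s * (s - 1) * (w k \<bullet> (x k - xs)) + s * (s - 1) * (d k \<bullet> (z k - xs))"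
    by (simp add: d_def inner_simps algebra_simps)
  have Nl: "(\<eta> * s\<^sup>2 / 3 + \<eta> * (real k + 1) / (4 * (s - 2))) * n \<le>
     (N k - \<eta> / (s - 2)\<^sup>2 - s * (s - 1) * \<rho> - (s - 1) * \<eta> / (s - 2)) * n"
    using N_lower nn by (intro mult_right_mono) auto
  have co: "(s - 1) * \<eta> / (s - 2) * \<Delta> + (s - 1) * \<eta> / (2 * (s - 2)) * (tm k)\<^sup>2 * \<Delta> \<le> 3/4 * \<eta> * (tm k)\<^sup>2 * \<Delta>"
  proof -
    have "(s - 1) / (s - 2) \<le> 6/5" using s_gt by (simp add: field_simps)
    then have a: "(s - 1) / (s - 2) * (\<eta> * \<Delta>) \<le> 6/5 * (\<eta> * \<Delta>)"
       and b: "(s - 1) / (s - 2) * (\<eta> * (tm k)\<^sup>2 * \<Delta>) \<le> 6/5 * (\<eta> * (tm k)\<^sup>2 * \<Delta>)"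
      using nn eta_pos by (intro mult_right_mono; simp)+
    have "7\<^sup>2 \<le> (tm k)\<^sup>2" using tm_ge[of k] by (intro power_mono) auto
    then have "49 * (\<eta> * \<Delta>) \<le> (tm k)\<^sup>2 * (\<eta> * \<Delta>)" using nn eta_pos by (intro mult_right_mono) auto
    then have c: "49 * (\<eta> * \<Delta>) \<le> \<eta> * (tm k)\<^sup>2 * \<Delta>" by (simp add: mult_ac)
    have "(s - 1) * \<eta> / (s - 2) * \<Delta> + (s - 1) * \<eta> / (2 * (s - 2)) * (tm k)\<^sup>2 * \<Delta>
      = (s - 1) / (s - 2) * (\<eta> * \<Delta>) + (s - 1) / (s - 2) * (\<eta> * (tm k)\<^sup>2 * \<Delta>) / 2"
      by (simp add: mult_ac)
    also have "\<dots> \<le> 3/4 * (\<eta> * (tm k)\<^sup>2 * \<Delta>)"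
    proof -
      define Q X Y where "Q = (s - 1) / (s - 2)" and "X = \<eta> * \<Delta>" and "Y = \<eta> * (tm k)\<^sup>2 * \<Delta>"
      have "0 \<le> X" using nn eta_pos by (simp add: X_def)
      then show ?thesis
        using a b c unfolding Q_def[symmetric] X_def[symmetric] Y_def[symmetric] by linarith
    qed
    finally show ?thesis by simp
  qed
  from E_step[of k] z u dz m inn Nl co show ?thesis
    unfolding V_def n_def[symmetric] \<Delta>_def[symmetric] by (simp add: algebra_simps diff_divide_distrib)
qed

lemma Vb_step:
  assumes "xs \<in> zer_op G T"
  shows "Vb xs (Suc k) + \<eta> / 4 * (real k + 1) * tm (Suc k) * (norm (u (Suc k) - u k))\<^sup>2
        + \<eta> * (real k + 1) / (4 * (s - 2)) * (norm (w k))\<^sup>2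
      \<le> Vb xs k + 5 * \<eta> * (tm (Suc k))\<^sup>2 * (p (Suc k) + e2 (Suc k)) + 7 * \<eta> * (tm k)\<^sup>2 * (p k + e2 k)"
proof -
  have "5/2 * \<eta> * (tm (Suc k))\<^sup>2 * (norm (d (Suc k)))\<^sup>2 \<le> 5/2 * \<eta> * (tm (Suc k))\<^sup>2 * (2 * p (Suc k) + 2 * e2 (Suc k))"
    "7/2 * \<eta> * (tm k)\<^sup>2 * (norm (d k))\<^sup>2 \<le> 7/2 * \<eta> * (tm k)\<^sup>2 * (2 * p k + 2 * e2 k)"
    using eta_pos by (intro mult_left_mono d_le; simp)+
  with V_step[OF assms, of k] show ?thesis by (simp add: Vb_def algebra_simps)
qed

text \<open>Young's inequality spends all of the distance term of \<open>z\<close> and charges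
  \<open>\<eta> / (2 * (s - 1) * (s - 2))\<close> times \<open>tm k\<close> squared, below the
  quadratic coefficient of \<open>a k\<close> by \<open>eta_q_gt\<close>. The linear part
  \<open>q * s * tm k\<close> of \<open>a k\<close> covers \<open>\<rho>\<close> and the shift in
  \<open>Vb\<close>.\<close>

lemma Vb_nonneg:
  assumes xs: "xs \<in> zer_op G T"
  shows "Vb xs k \<ge> 0"
proof -
  define n where "n = (norm (w k))\<^sup>2"
  have n: "n \<ge> 0" by (simp add: n_def)
  have tk: "tm k > 0" "tm k \<ge> s" using tm_ge[of k] by (auto simp: tm_def)
  have ck: "c k > 0" using c_ge[of k] C_pos by linarith
  have 1: "s * tm k * (w k \<bullet> (x k - xs)) \<ge> s * tm k * (- \<rho> * n)"
    using s_gt tk w_zero_inner[OF xs, of k] unfolding n_def by (intro mult_left_mono) auto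
  have "s * tm k * ((z k - xs) \<bullet> w k) \<le> c k / 2 * (norm (z k - xs))\<^sup>2 + (s * tm k)\<^sup>2 / (4 * (c k / 2)) * n"
    unfolding n_def using ck by (intro inner_le_young) auto
  also have "(s * tm k)\<^sup>2 / (4 * (c k / 2)) * n \<le> (s * tm k)\<^sup>2 / (4 * (C / 2)) * n"
    using c_ge[of k] C_pos n by (intro mult_right_mono divide_left_mono mult_left_mono) auto
  also have "(s * tm k)\<^sup>2 / (4 * (C / 2)) = \<eta> / (2 * (s - 1) * (s - 2)) * (tm k)\<^sup>2"
    using s_gt eta_pos by (simp add: C_def power_mult_distrib divide_simps)
  finally have 2: "s * tm k * (w k \<bullet> (z k - xs)) \<le> c k / 2 * (norm (z k - xs))\<^sup>2 + \<eta> / (2 * (s - 1) * (s - 2)) * (tm k)\<^sup>2 * n"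
    by (simp add: inner_commute)
  have "\<eta> / (2 * (s - 1) * (s - 2)) \<le> 5 * \<eta> / (8 * (s - 1) * (s - 2))"
    using eta_pos s_gt by (simp add: divide_simps)
  then have "\<eta> / (2 * (s - 1) * (s - 2)) * (tm k)\<^sup>2 \<le> (\<eta> - q) * (tm k)\<^sup>2"
    using eta_q_gt by (intro mult_right_mono) auto
  moreover have "(3/5 * \<eta> + \<rho>) * (s * tm k) \<le> q * (s * tm k)"
    using q_ge s_gt tk by (intro mult_right_mono) auto
  moreover have "\<eta> * s * s \<le> \<eta> * s * tm k"
    using eta_pos s_gt tk by (intro mult_left_mono) auto
  moreover have "0 \<le> \<eta> * s * s" using eta_pos s_gt by simp
  ultimately have "0 \<le> a k - \<eta> / (2 * (s - 1) * (s - 2)) * (tm k)\<^sup>2 - s * tm k * \<rho> - \<eta> * s\<^sup>2 / 3"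
    unfolding a_eq power2_eq_square[of s] by (simp add: algebra_simps)
  then have "0 \<le> (a k - \<eta> / (2 * (s - 1) * (s - 2)) * (tm k)\<^sup>2 - s * tm k * \<rho> - \<eta> * s\<^sup>2 / 3) * n"
    using n by simp
  moreover have "s * tm k * (w k \<bullet> (x k - z k)) = s * tm k * (w k \<bullet> (x k - xs)) - s * tm k * (w k \<bullet> (z k - xs))"
    by (simp add: inner_simps algebra_simps)
  ultimately show ?thesis
    using 1 2 unfolding Vb_def V_def E_def n_def[symmetric] by (simp add: algebra_simps)
qed

text \<open>The new \<open>p (Suc k)\<close> is charged 5 times by \<open>Vb_step\<close>, 7 times
  more by the following step, and \<open>K / 2\<close> times for the error condition, hence
  \<open>12 + K / 2\<close>. By \<open>p_Suc\<close> all of it is a multiple of the squared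
  increment of \<open>u\<close>; the factor \<open>s + 1\<close> comes from
  \<open>tm (Suc k) \<le> (s + 1) * (k + 1)\<close>. The spare \<open>\<zeta>\<close> keeps part of
  that increment for summability.\<close>

lemma lyapunov_step:
  assumes xs: "xs \<in> zer_op G T" and K: "K \<ge> 0"
    and chi: "\<zeta> + L\<^sup>2 * \<eta>\<^sup>2 * (s + 1) * (12 + K / 2) \<le> 1 / 4"
  shows "Vb xs (Suc k) + \<eta> * (tm (Suc k))\<^sup>2 * (7 + K / 2) * p (Suc k)
       + (\<eta> * \<zeta> * ((real k + 1) * tm (Suc k) * (norm (u (Suc k) - u k))\<^sup>2)
          + \<eta> / (4 * (s - 2)) * ((real k + 1) * (norm (w k))\<^sup>2))
     \<le> Vb xs k + 7 * (\<eta> * (tm k)\<^sup>2) * p k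
       + 5 * (\<eta> * (tm (Suc k))\<^sup>2) * e2 (Suc k) + 7 * (\<eta> * (tm k)\<^sup>2) * e2 k"
proof -
  define U where "U = (real k + 1) * tm (Suc k) * (norm (u (Suc k) - u k))\<^sup>2"
  define Z where "Z = (12 + K / 2) * (L\<^sup>2 * \<eta>\<^sup>2)"
  have t: "tm (Suc k) > 0" "tm (Suc k) \<le> (s + 1) * (real k + 1)"
    using s_gt by (auto simp: tm_def algebra_simps)
  have U: "U \<ge> 0" using t by (simp add: U_def)
  have Z: "Z \<ge> 0" using K by (simp add: Z_def)
  have "(tm (Suc k))\<^sup>2 * (12 + K / 2) * p (Suc k) = Z * (tm (Suc k) * (tm (Suc k) * (norm (u (Suc k) - u k))\<^sup>2))"
    by (simp add: p_Suc Z_def power2_eq_square)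
  also have "\<dots> \<le> Z * (((s + 1) * (real k + 1)) * (tm (Suc k) * (norm (u (Suc k) - u k))\<^sup>2))"
    using t Z by (intro mult_left_mono mult_right_mono) auto
  also have "\<dots> = L\<^sup>2 * \<eta>\<^sup>2 * (s + 1) * (12 + K / 2) * U"
    by (simp add: Z_def U_def)
  also have "\<dots> \<le> (1 / 4 - \<zeta>) * U"
    using chi U by (intro mult_right_mono) auto
  finally have "(tm (Suc k))\<^sup>2 * (12 + K / 2) * p (Suc k) \<le> (1 / 4 - \<zeta>) * U" .
  then have "\<eta> * ((tm (Suc k))\<^sup>2 * (12 + K / 2) * p (Suc k)) \<le> \<eta> * ((1 / 4 - \<zeta>) * U)"
    using eta_pos by (intro mult_left_mono) auto
  moreover have eqU: "\<eta> / 4 * (real k + 1) * tm (Suc k) * (norm (u (Suc k) - u k))\<^sup>2 = \<eta> / 4 * U"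
    by (simp add: U_def)
  moreover define X where "X = \<eta> / (4 * (s - 2)) * ((real k + 1) * (norm (w k))\<^sup>2)"
  moreover have eqX: "\<eta> * (real k + 1) / (4 * (s - 2)) * (norm (w k))\<^sup>2 = X"
    by (simp add: X_def)
  ultimately show ?thesis
    using Vb_step[OF xs, of k, unfolded eqU eqX] unfolding U_def[symmetric] X_def[symmetric]
    by (simp add: algebra_simps)
qed

section \<open>The gap between \<open>x\<close> and \<open>z\<close>, and two-sided bounds on the
  energy\<close>

lemma x_minus_z_Suc: "x (Suc k) - z (Suc k) = ((real k + 1) / tm (Suc k)) *\<^sub>R (x k - z k)
   + ((\<beta> k + \<gamma> k / s) *\<^sub>R u k - \<eta> *\<^sub>R u (Suc k))"
proof -
  have t: "real k + s + 1 = tm (Suc k)" by (simp add: tm_def)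
  have f: "s / tm (Suc k) = 1 - (real k + 1) / tm (Suc k)"
    using tm_ge[of "Suc k"] by (simp add: tm_def field_simps)
  show ?thesis
    unfolding x_Suc z_Suc t f u_def by (simp add: algebra_simps)
qed

lemma beta_gamma_le: "\<bar>\<beta> k + \<gamma> k / s\<bar> \<le> 3 * \<eta>"
proof -
  have t: "tm (Suc k) > 1" using tm_ge[of "Suc k"] by simp
  have "\<beta> k = B * ((real k + 1) / tm (Suc k)) - \<gamma> k / tm (Suc k)"
  proof -
    have "\<beta> k = (B * (real k + 1) - \<gamma> k) / tm (Suc k)"
      using beta_gamma[of k] t by (simp add: eq_divide_eq mult.commute)
    then show ?thesis by (simp add: diff_divide_distrib)
  qed
  moreover have "B * ((real k + 1) / tm (Suc k)) \<le> \<eta> * 1"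
    using B_le B_nonneg eta_pos t s_gt by (intro mult_mono) (auto simp: tm_def)
  moreover have "0 \<le> B * ((real k + 1) / tm (Suc k))" using B_nonneg t by simp
  moreover have g: "\<gamma> k \<le> \<eta>"
  proof -
    have "\<eta> / (s - 2) \<le> \<eta>" using s_gt eta_pos by (simp add: field_simps)
    with gamma_le[of k] show ?thesis by linarith
  qed
  moreover have "\<gamma> k / tm (Suc k) \<le> \<gamma> k" "\<gamma> k / s \<le> \<gamma> k" "0 \<le> \<gamma> k / tm (Suc k)" "0 \<le> \<gamma> k / s"
    using gamma_nonneg[of k] t s_gt by (auto simp: divide_simps mult_le_cancel_left1)
  ultimately show ?thesis using gamma_nonneg[of k] by (simp add: abs_le_iff)
qed

definition "a0 = 5 * \<eta> / (8 * (s - 1) * (s - 2))"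

lemma a0_pos: "a0 > 0" using eta_pos s_gt by (simp add: a0_def)

text \<open>The energy itself may be negative; a multiple of the squared gap between
  \<open>x\<close> and \<open>z\<close> restores nonnegativity. The constant \<open>a0\<close> is
  the lower bound of \<open>\<eta> - q\<close> from \<open>eta_q_gt\<close>.\<close>

lemma E_lower: "a0 / 2 * (tm k)\<^sup>2 * (norm (w k))\<^sup>2 \<le> E k + s\<^sup>2 / (2 * a0) * (norm (x k - z k))\<^sup>2"
proof -
  have tk: "tm k > 0" using tm_ge[of k] by simp
  have q: "q \<ge> 0" using q_ge eta_pos rho_nonneg by simp
  note a_eq[of k]
  moreover have "a0 * (tm k)\<^sup>2 \<le> (\<eta> - q) * (tm k)\<^sup>2"
    using eta_q_gt by (intro mult_right_mono) (auto simp: a0_def)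
  moreover have "0 \<le> q * s * tm k" using q s_gt tk by simp
  ultimately have "a0 * (tm k)\<^sup>2 \<le> a k" by linarith
  then have 1: "a0 * (tm k)\<^sup>2 * (norm (w k))\<^sup>2 \<le> a k * (norm (w k))\<^sup>2" by (intro mult_right_mono) auto
  have "(- s * tm k) * (w k \<bullet> (x k - z k)) \<le> a0 / 2 * (tm k)\<^sup>2 * (norm (w k))\<^sup>2
     + (- s * tm k)\<^sup>2 / (4 * (a0 / 2 * (tm k)\<^sup>2)) * (norm (x k - z k))\<^sup>2"
    using a0_pos tk by (intro inner_le_young) auto
  also have "(- s * tm k)\<^sup>2 / (4 * (a0 / 2 * (tm k)\<^sup>2)) = s\<^sup>2 / (2 * a0)"
    using tk a0_pos by (simp add: power_mult_distrib)
  finally show ?thesis using 1 by (simp add: E_def)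
qed

lemma E_upper: "E k \<le> (s\<^sup>2 + \<eta>) * (tm k)\<^sup>2 * (norm (w k))\<^sup>2 + (norm (x k - z k))\<^sup>2"
proof -
  have tk: "tm k > 0" using tm_ge[of k] by simp
  have q: "q \<ge> 0" using q_ge eta_pos rho_nonneg by simp
  have "a k \<le> \<eta> * (tm k)\<^sup>2" using q tk by (simp add: a_def power2_eq_square algebra_simps)
  then have 1: "a k * (norm (w k))\<^sup>2 \<le> \<eta> * (tm k)\<^sup>2 * (norm (w k))\<^sup>2" by (intro mult_right_mono) auto
  have "(s * tm k) * (w k \<bullet> (x k - z k)) \<le> (s\<^sup>2 * (tm k)\<^sup>2) * (norm (w k))\<^sup>2
     + (s * tm k)\<^sup>2 / (4 * (s\<^sup>2 * (tm k)\<^sup>2)) * (norm (x k - z k))\<^sup>2"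
    using s_gt tk by (intro inner_le_young) auto
  also have "(s * tm k)\<^sup>2 / (4 * (s\<^sup>2 * (tm k)\<^sup>2)) * (norm (x k - z k))\<^sup>2 \<le> (norm (x k - z k))\<^sup>2"
    using tk s_gt by (simp add: power_mult_distrib)
  finally show ?thesis using 1 by (simp add: E_def algebra_simps)
qed

end

section \<open>Asymptotics of a trajectory with summable errors\<close>

locale vfog_summable_path = vfog_path +
  assumes sum_w: "summable (\<lambda>k. (real k + 1) * (norm (w k))\<^sup>2)"
    and sum_du: "summable (\<lambda>k. (real k + 1) * tm (Suc k) * (norm (u (Suc k) - u k))\<^sup>2)"
    and sum_e: "summable (\<lambda>k. (tm k)\<^sup>2 * e2 k)"
begin

lemma tm_le: "tm k \<le> s * (real k + 1)"
proof -
  have "1 * real k \<le> s * real k" using s_gt by (intro mult_right_mono) auto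
  then show ?thesis by (simp add: tm_def algebra_simps)
qed

lemma sum_p: "summable (\<lambda>k. (tm k)\<^sup>2 * p k)"
proof -
  have "summable (\<lambda>k. (tm (Suc k))\<^sup>2 * p (Suc k))"
  proof (rule summable_nonneg_le)
    show "summable (\<lambda>k. (2 * s * L\<^sup>2 * \<eta>\<^sup>2) * ((real k + 1) * tm (Suc k) * (norm (u (Suc k) - u k))\<^sup>2))"
      by (intro summable_mult sum_du)
    fix k
    show "0 \<le> (tm (Suc k))\<^sup>2 * p (Suc k)" using p_nonneg by simp
    have "tm (Suc k) \<le> 2 * (s * (real k + 1))" using tm_le[of k] tm_ge[of k] tm_Suc[of k] by linarith
    then have "tm (Suc k) * (tm (Suc k) * p (Suc k)) \<le> 2 * (s * (real k + 1)) * (tm (Suc k) * p (Suc k))"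
      using p_nonneg tm_ge[of "Suc k"] by (intro mult_right_mono) auto
    moreover have "2 * (s * (real k + 1)) * (tm (Suc k) * p (Suc k))
        = (2 * s * L\<^sup>2 * \<eta>\<^sup>2) * ((real k + 1) * tm (Suc k) * (norm (u (Suc k) - u k))\<^sup>2)"
      by (simp add: p_Suc mult_ac)
    ultimately show "(tm (Suc k))\<^sup>2 * p (Suc k)
        \<le> (2 * s * L\<^sup>2 * \<eta>\<^sup>2) * ((real k + 1) * tm (Suc k) * (norm (u (Suc k) - u k))\<^sup>2)"
      by (simp only: power2_eq_square[of "tm (Suc k)"] mult.assoc)
  qed
  then show ?thesis by (subst (asm) summable_Suc_iff)
qed

lemma sum_d: "summable (\<lambda>k. (tm k)\<^sup>2 * (norm (d k))\<^sup>2)"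
proof (rule summable_nonneg_le)
  show "summable (\<lambda>k. 2 * ((tm k)\<^sup>2 * p k) + 2 * ((tm k)\<^sup>2 * e2 k))"
    by (intro summable_add summable_mult sum_p sum_e)
  show "(tm k)\<^sup>2 * (norm (d k))\<^sup>2 \<le> 2 * ((tm k)\<^sup>2 * p k) + 2 * ((tm k)\<^sup>2 * e2 k)" for k
    using mult_left_mono[OF d_le[of k], of "(tm k)\<^sup>2"] by (simp add: algebra_simps)
qed simp

lemma sum_tw: "summable (\<lambda>k. tm k * (norm (w k))\<^sup>2)"
proof (rule summable_nonneg_le)
  show "summable (\<lambda>k. s * ((real k + 1) * (norm (w k))\<^sup>2))" by (intro summable_mult sum_w)
  show "tm k * (norm (w k))\<^sup>2 \<le> s * ((real k + 1) * (norm (w k))\<^sup>2)" for k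
    using mult_right_mono[OF tm_le[of k], of "(norm (w k))\<^sup>2"] by (simp add: mult_ac)
  show "0 \<le> tm k * (norm (w k))\<^sup>2" for k using tm_ge[of k] by simp
qed

lemma sum_tu: "summable (\<lambda>k. tm k * (norm (u k))\<^sup>2)"
proof (rule summable_nonneg_le)
  show "summable (\<lambda>k. 2 * (tm k * (norm (w k))\<^sup>2) + 2 * ((tm k)\<^sup>2 * (norm (d k))\<^sup>2))"
    by (intro summable_add summable_mult sum_tw sum_d)
  fix k
  have t: "tm k \<ge> 1" using tm_ge[of k] by simp
  show "0 \<le> tm k * (norm (u k))\<^sup>2" using t by simp
  have "(norm (u k))\<^sup>2 \<le> 2 * (norm (w k))\<^sup>2 + 2 * (norm (d k))\<^sup>2"
    using norm_diff_sq_le[of "w k" "d k"] by (simp add: d_def)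
  then have "tm k * (norm (u k))\<^sup>2 \<le> tm k * (2 * (norm (w k))\<^sup>2 + 2 * (norm (d k))\<^sup>2)"
    using t by (intro mult_left_mono) auto
  moreover have "tm k * (norm (d k))\<^sup>2 \<le> (tm k)\<^sup>2 * (norm (d k))\<^sup>2"
    using t by (intro mult_right_mono) (auto simp: power2_eq_square)
  ultimately show "tm k * (norm (u k))\<^sup>2 \<le> 2 * (tm k * (norm (w k))\<^sup>2) + 2 * ((tm k)\<^sup>2 * (norm (d k))\<^sup>2)"
    by (simp add: algebra_simps)
qed

text \<open>The perturbation in \<open>x_minus_z_Suc\<close> is linear in \<open>u\<close>, and the
  charge t / s of \<open>norm_sq_convex_le\<close> is just what \<open>sum_tu\<close> affords. The
  contraction loss \<open>s / tm (Suc k) * D k\<close> is then summable, and a convergent sequence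
  with this property tends to 0.\<close>

lemma x_minus_z_asymptotics:
  "(\<lambda>k. (norm (x k - z k))\<^sup>2) \<longlonglongrightarrow> 0" "summable (\<lambda>k. (norm (x k - z k))\<^sup>2 / tm k)"
proof -
  define D where "D k = (norm (x k - z k))\<^sup>2" for k
  define f where "f k = (\<beta> k + \<gamma> k / s) *\<^sub>R u k - \<eta> *\<^sub>R u (Suc k)" for k
  have f: "(norm (f k))\<^sup>2 \<le> 18 * \<eta>\<^sup>2 * (norm (u k))\<^sup>2 + 2 * \<eta>\<^sup>2 * (norm (u (Suc k)))\<^sup>2" for k
  proof -
    have "(norm (f k))\<^sup>2 \<le> 2 * ((\<beta> k + \<gamma> k / s)\<^sup>2 * (norm (u k))\<^sup>2) + 2 * (\<eta>\<^sup>2 * (norm (u (Suc k)))\<^sup>2)"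
      unfolding f_def using norm_diff_sq_le[of "(\<beta> k + \<gamma> k / s) *\<^sub>R u k" "\<eta> *\<^sub>R u (Suc k)"]
      by (simp add: power_mult_distrib)
    moreover have "(\<beta> k + \<gamma> k / s)\<^sup>2 \<le> (3 * \<eta>)\<^sup>2"
      using beta_gamma_le[of k] eta_pos by (intro power2_le_iff_abs_le[THEN iffD2]) auto
    then have "(\<beta> k + \<gamma> k / s)\<^sup>2 * (norm (u k))\<^sup>2 \<le> (3 * \<eta>)\<^sup>2 * (norm (u k))\<^sup>2"
      by (intro mult_right_mono) auto
    ultimately show ?thesis by (simp add: power_mult_distrib)
  qed
  have step: "D (Suc k) + s / tm (Suc k) * D k \<le> D k + tm (Suc k) / s * (norm (f k))\<^sup>2" for k
  proof -
    define m where "m = (real k + 1) / tm (Suc k)"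
    have t: "tm (Suc k) > 0" using tm_ge[of "Suc k"] by simp
    have m: "0 \<le> m" "m < 1" "1 - m = s / tm (Suc k)" using t s_gt by (auto simp: m_def tm_def field_simps)
    have "D (Suc k) \<le> m * D k + (norm (f k))\<^sup>2 / (1 - m)"
      unfolding D_def x_minus_z_Suc m_def[symmetric] f_def[symmetric] using m by (intro norm_sq_convex_le) auto
    moreover have "m = 1 - s / tm (Suc k)" using m by simp
    ultimately show ?thesis using m(3) by (simp add: algebra_simps)
  qed
  have sf: "summable (\<lambda>k. tm (Suc k) / s * (norm (f k))\<^sup>2)"
  proof (rule summable_nonneg_le)
    show "summable (\<lambda>k. 36 * \<eta>\<^sup>2 * (tm k * (norm (u k))\<^sup>2) + 2 * \<eta>\<^sup>2 * (tm (Suc k) * (norm (u (Suc k)))\<^sup>2))"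
      by (intro summable_add summable_mult sum_tu sum_tu[THEN summable_Suc_iff[THEN iffD2]])
    fix k
    have t: "tm (Suc k) > 0" "tm (Suc k) \<le> 2 * tm k" using tm_ge[of k] by (auto simp: tm_Suc)
    show "0 \<le> tm (Suc k) / s * (norm (f k))\<^sup>2" using t s_gt by simp
    have "tm (Suc k) / s * (norm (f k))\<^sup>2 \<le> tm (Suc k) * (norm (f k))\<^sup>2"
      using t s_gt by (intro mult_right_mono) (auto simp: divide_simps)
    also have "\<dots> \<le> tm (Suc k) * (18 * \<eta>\<^sup>2 * (norm (u k))\<^sup>2 + 2 * \<eta>\<^sup>2 * (norm (u (Suc k)))\<^sup>2)"
      using t f[of k] by (intro mult_left_mono) auto
    also have "\<dots> = tm (Suc k) * (18 * \<eta>\<^sup>2 * (norm (u k))\<^sup>2) + 2 * \<eta>\<^sup>2 * (tm (Suc k) * (norm (u (Suc k)))\<^sup>2)"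
      by (simp add: algebra_simps)
    also have "tm (Suc k) * (18 * \<eta>\<^sup>2 * (norm (u k))\<^sup>2) \<le> (2 * tm k) * (18 * \<eta>\<^sup>2 * (norm (u k))\<^sup>2)"
      using t by (intro mult_right_mono) auto
    finally show "tm (Suc k) / s * (norm (f k))\<^sup>2 \<le> 36 * \<eta>\<^sup>2 * (tm k * (norm (u k))\<^sup>2) + 2 * \<eta>\<^sup>2 * (tm (Suc k) * (norm (u (Suc k)))\<^sup>2)"
      by (simp add: mult_ac)
  qed
  have g: "0 \<le> s / tm (Suc k) * D k" "0 \<le> D k" for k using s_gt tm_ge[of "Suc k"] by (auto simp: D_def)
  note conv = quasi_decreasing_convergent[OF step g(1) sf g(2)]
  have sD: "summable (\<lambda>k. D k / tm k)"
  proof (rule summable_nonneg_le[OF conv(2)])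
    fix k
    show "0 \<le> D k / tm k" using g(2) tm_ge[of k] by simp
    have "1 / tm k \<le> s / tm (Suc k)"
    proof -
      have "s * tm k \<ge> 2 * tm k" using s_gt tm_ge[of k] by (intro mult_right_mono) auto
      then have "tm k + 1 \<le> s * tm k" using tm_ge[of k] by linarith
      then show ?thesis using tm_ge[of k] by (simp add: tm_Suc divide_simps)
    qed
    then show "D k / tm k \<le> s / tm (Suc k) * D k" using mult_right_mono[OF _ g(2)] by fastforce
  qed
  then show "summable (\<lambda>k. (norm (x k - z k))\<^sup>2 / tm k)" by (simp add: D_def)
  show "(\<lambda>k. (norm (x k - z k))\<^sup>2) \<longlonglongrightarrow> 0"
    using tendsto_zero_of_weighted_summable[OF conv(1) g(2), of s] sD s_gt
    by (simp add: D_def tm_def)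
qed

lemma E_tendsto: "E \<longlonglongrightarrow> 0" and tw_tendsto: "(\<lambda>k. (tm k)\<^sup>2 * (norm (w k))\<^sup>2) \<longlonglongrightarrow> 0"
proof -
  define D where "D k = (norm (x k - z k))\<^sup>2" for k
  have D: "D \<longlonglongrightarrow> 0" "summable (\<lambda>k. D k / tm k)" "\<And>k. 0 \<le> D k"
    using x_minus_z_asymptotics by (auto simp: D_def[abs_def])
  define K where "K = s\<^sup>2 / (2 * a0)"
  have K: "K \<ge> 0" using a0_pos by (simp add: K_def)
  obtain M where M: "\<And>k. D k \<le> M"
    using convergent_imp_Bseq[OF convergentI[OF D(1)]] unfolding Bseq_def by (force simp: abs_le_iff)
  define b where "b k = s * (s - 1) * (tm k * (norm (w k))\<^sup>2) + s * (s - 1) * (D k / tm k)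
     + \<eta> * s\<^sup>2 / 3 * (tm (Suc k) * (norm (w (Suc k)))\<^sup>2)
     + 5/2 * \<eta> * ((tm (Suc k))\<^sup>2 * (norm (d (Suc k)))\<^sup>2) + 11/4 * \<eta> * ((tm k)\<^sup>2 * (norm (d k))\<^sup>2)" for k
  have b: "summable b"
    unfolding b_def
    by (intro summable_add summable_mult sum_tw sum_d D(2) sum_tw[THEN summable_Suc_iff[THEN iffD2]]
        sum_d[THEN summable_Suc_iff[THEN iffD2]])
  have step: "E (Suc k) + 0 \<le> E k + b k" for k
  proof -
    have t: "tm k > 1" "tm (Suc k) > 1" using tm_ge[of k] by (auto simp: tm_Suc)
    \<comment> \<open>The weight \<open>tm k\<close> splits the product into two sequences already
      known to be summable.\<close>
    have "s * (s - 1) * ((- 1) * (w k \<bullet> (x k - z k))) \<le> s * (s - 1) * (tm k * (norm (w k))\<^sup>2 + (-1)\<^sup>2 / (4 * tm k) * D k)"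
      unfolding D_def using t s_gt by (intro mult_left_mono inner_le_young) auto
    also have "\<dots> \<le> s * (s - 1) * (tm k * (norm (w k))\<^sup>2 + D k / tm k)"
      using t s_gt D(3)[of k] by (intro mult_left_mono add_left_mono) (auto simp: divide_simps)
    finally have 1: "- s * (s - 1) * (w k \<bullet> (x k - z k)) \<le> s * (s - 1) * (tm k * (norm (w k))\<^sup>2) + s * (s - 1) * (D k / tm k)"
      by (simp add: distrib_left)
    have "0 \<le> N k - \<eta> / (s - 2)\<^sup>2"
    proof -
      have "0 \<le> s * (s - 1) * \<rho>" "0 \<le> (s - 1) * \<eta> / (s - 2)" "0 \<le> \<eta> * s\<^sup>2 / 3" "0 \<le> \<eta> * (real k + 1) / (4 * (s - 2))"
        using s_gt eta_pos rho_nonneg by auto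
      then show ?thesis using N_lower[of k] by linarith
    qed
    then have 2: "0 \<le> (N k - \<eta> / (s - 2)\<^sup>2) * (norm (w k))\<^sup>2" by simp
    have "(norm (w (Suc k)))\<^sup>2 \<le> tm (Suc k) * (norm (w (Suc k)))\<^sup>2"
      using t by (simp add: mult_le_cancel_right1)
    then have 3: "\<eta> * s\<^sup>2 / 3 * (norm (w (Suc k)))\<^sup>2 \<le> \<eta> * s\<^sup>2 / 3 * (tm (Suc k) * (norm (w (Suc k)))\<^sup>2)"
      using eta_pos by (intro mult_left_mono) auto
    have 4: "0 \<le> \<eta> / 4 * (real k + 1) * tm (Suc k) * (norm (u (Suc k) - u k))\<^sup>2"
      using eta_pos t by simp
    from E_step[of k] 1 2 3 4 show ?thesis by (simp add: b_def mult.assoc)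
  qed
  have "- (K * M) \<le> E k" for k
  proof -
    have "0 \<le> a0 / 2 * (tm k)\<^sup>2 * (norm (w k))\<^sup>2" using a0_pos by simp
    then have "0 \<le> E k + K * D k" using E_lower[of k] unfolding K_def D_def by linarith
    moreover have "K * D k \<le> K * M" using K M by (intro mult_left_mono) auto
    ultimately show ?thesis by linarith
  qed
  then have E: "convergent E" by (intro quasi_decreasing_convergent(1)[OF step _ b]) auto
  \<comment> \<open>Unlike \<open>E\<close>, this sequence is nonnegative, as the weighted
    summability criterion requires; the correction tends to 0.\<close>
  define H where "H k = E k + K * D k" for k
  have "convergent H" unfolding H_def
    by (intro convergent_add E convergent_mult convergent_const) (use D(1) in \<open>auto simp: convergent_def\<close>)
  moreover have H_low: "a0 / 2 * ((tm k)\<^sup>2 * (norm (w k))\<^sup>2) \<le> H k" for k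
    using E_lower[of k] unfolding K_def D_def H_def by (simp add: mult.assoc)
  have H_nn: "0 \<le> H k" for k
  proof -
    have "0 \<le> a0 / 2 * ((tm k)\<^sup>2 * (norm (w k))\<^sup>2)" using a0_pos by simp
    with H_low[of k] show ?thesis by linarith
  qed
  moreover have "summable (\<lambda>k. H k / tm k)"
  proof (rule summable_nonneg_le)
    show "summable (\<lambda>k. (s\<^sup>2 + \<eta>) * (tm k * (norm (w k))\<^sup>2) + (1 + K) * (D k / tm k))"
      by (intro summable_add summable_mult sum_tw D(2))
    fix k
    have t: "tm k > 0" using tm_ge[of k] by simp
    show "0 \<le> H k / tm k" using t H_nn by simp
    have "H k \<le> (s\<^sup>2 + \<eta>) * (tm k)\<^sup>2 * (norm (w k))\<^sup>2 + (1 + K) * D k"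
      using E_upper[of k] unfolding H_def D_def by (simp add: algebra_simps)
    then have "H k / tm k \<le> ((s\<^sup>2 + \<eta>) * (tm k)\<^sup>2 * (norm (w k))\<^sup>2 + (1 + K) * D k) / tm k"
      using t by (intro divide_right_mono) auto
    then show "H k / tm k \<le> (s\<^sup>2 + \<eta>) * (tm k * (norm (w k))\<^sup>2) + (1 + K) * (D k / tm k)"
      using t by (simp add: add_divide_distrib power2_eq_square)
  qed
  ultimately have H: "H \<longlonglongrightarrow> 0"
    using tendsto_zero_of_weighted_summable[of H s] s_gt by (simp add: tm_def)
  have "(\<lambda>k. H k - K * D k) \<longlonglongrightarrow> 0 - K * 0"
    by (intro tendsto_intros H D(1))
  then show "E \<longlonglongrightarrow> 0" by (simp add: H_def)
  have "(\<lambda>k. 2 / a0 * H k) \<longlonglongrightarrow> 2 / a0 * 0" by (intro tendsto_intros H)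
  then have H2: "(\<lambda>k. 2 / a0 * H k) \<longlonglongrightarrow> 0" by simp
  have "(tm k)\<^sup>2 * (norm (w k))\<^sup>2 \<le> 2 / a0 * H k" for k
    using H_low[of k] a0_pos by (simp add: field_simps)
  then show "(\<lambda>k. (tm k)\<^sup>2 * (norm (w k))\<^sup>2) \<longlonglongrightarrow> 0"
    by (intro tendsto_sandwich[OF _ _ tendsto_const H2]) auto
qed

section \<open>Rates at the points \<open>y\<close> and convergence of the iterates\<close>

lemma Gy_le: "(norm (G (y k) + v k))\<^sup>2 \<le> 2 * (norm (w k))\<^sup>2 + 2 * p k"
proof -
  have eq: "G (y k) + v k = w k - (G (x k) - G (y k))" by (simp add: w_def)
  have "(norm (G (y k) + v k))\<^sup>2 \<le> 2 * (norm (w k))\<^sup>2 + 2 * (norm (G (x k) - G (y k)))\<^sup>2"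
    unfolding eq by (rule norm_diff_sq_le)
  with lipschitz[of "x k" "y k"] show ?thesis by (simp add: p_def)
qed

lemma sum_Gy: "summable (\<lambda>k. (real k + s) * (norm (G (y k) + v k))\<^sup>2)"
proof (rule summable_nonneg_le)
  show "summable (\<lambda>k. 2 * (tm k * (norm (w k))\<^sup>2) + 2 * ((tm k)\<^sup>2 * p k))"
    by (intro summable_add summable_mult sum_tw sum_p)
  fix k
  have t: "tm k \<ge> 1" using tm_ge[of k] by simp
  then show "0 \<le> (real k + s) * (norm (G (y k) + v k))\<^sup>2" by (simp add: tm_def)
  have "tm k * p k \<le> (tm k)\<^sup>2 * p k"
    using t p_nonneg[of k] by (intro mult_right_mono) (auto simp: power2_eq_square)
  moreover have "tm k * (norm (G (y k) + v k))\<^sup>2 \<le> tm k * (2 * (norm (w k))\<^sup>2 + 2 * p k)"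
    using t Gy_le[of k] by (intro mult_left_mono) auto
  ultimately have "tm k * (norm (G (y k) + v k))\<^sup>2 \<le> 2 * (tm k * (norm (w k))\<^sup>2) + 2 * ((tm k)\<^sup>2 * p k)"
    by (simp add: algebra_simps)
  then show "(real k + s) * (norm (G (y k) + v k))\<^sup>2 \<le> 2 * (tm k * (norm (w k))\<^sup>2) + 2 * ((tm k)\<^sup>2 * p k)"
    by (simp add: tm_def)
qed

lemma w_rate: "(\<lambda>k. (real k)\<^sup>2 * (norm (w k))\<^sup>2) \<longlonglongrightarrow> 0"
proof (rule tendsto_sandwich[OF _ _ tendsto_const tw_tendsto])
  have "(real k)\<^sup>2 \<le> (tm k)\<^sup>2" for k using s_gt by (intro power_mono) (auto simp: tm_def)
  then show "\<forall>\<^sub>F k in sequentially. (real k)\<^sup>2 * (norm (w k))\<^sup>2 \<le> (tm k)\<^sup>2 * (norm (w k))\<^sup>2"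
    by (intro always_eventually allI mult_right_mono) auto
qed auto

lemma Gy_rate: "(\<lambda>k. (real k)\<^sup>2 * (norm (G (y k) + v k))\<^sup>2) \<longlonglongrightarrow> 0"
proof (rule tendsto_sandwich[OF _ _ tendsto_const])
  have "(\<lambda>k. 2 * ((tm k)\<^sup>2 * (norm (w k))\<^sup>2) + 2 * ((tm k)\<^sup>2 * p k)) \<longlonglongrightarrow> 2 * 0 + 2 * 0"
    by (intro tendsto_intros tw_tendsto summable_LIMSEQ_zero sum_p)
  then show "(\<lambda>k. 2 * ((tm k)\<^sup>2 * (norm (w k))\<^sup>2) + 2 * ((tm k)\<^sup>2 * p k)) \<longlonglongrightarrow> 0" by simp
  have "(real k)\<^sup>2 \<le> (tm k)\<^sup>2" for k using s_gt by (intro power_mono) (auto simp: tm_def)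
  then have "(real k)\<^sup>2 * (norm (G (y k) + v k))\<^sup>2 \<le> (tm k)\<^sup>2 * (2 * (norm (w k))\<^sup>2 + 2 * p k)" for k
    by (intro mult_mono Gy_le) auto
  then show "\<forall>\<^sub>F k in sequentially. (real k)\<^sup>2 * (norm (G (y k) + v k))\<^sup>2 \<le> 2 * ((tm k)\<^sup>2 * (norm (w k))\<^sup>2) + 2 * ((tm k)\<^sup>2 * p k)"
    by (intro always_eventually allI) (simp add: algebra_simps)
qed auto

lemma w_sq_tendsto: "(\<lambda>k. (norm (w k))\<^sup>2) \<longlonglongrightarrow> 0"
proof (rule tendsto_sandwich[OF _ _ tendsto_const tw_tendsto])
  have "1 \<le> (tm k)\<^sup>2" for k using tm_ge[of k] by simp
  then show "\<forall>\<^sub>F k in sequentially. (norm (w k))\<^sup>2 \<le> (tm k)\<^sup>2 * (norm (w k))\<^sup>2"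
    by (intro always_eventually allI) (simp add: mult_le_cancel_right1)
qed auto

lemma c_tendsto: "c \<longlonglongrightarrow> C"
proof -
  have "(\<lambda>k. C + C * inverse (real k + (s - 1))) \<longlonglongrightarrow> C + C * 0"
    by (intro tendsto_intros tendsto_inverse_0_at_top filterlim_at_top_mono[OF filterlim_real_sequentially])
       (use s_gt in auto)
  moreover have "c = (\<lambda>k. C + C * inverse (real k + (s - 1)))"
  proof
    show "c k = C + C * inverse (real k + (s - 1))" for k
      using tm_ge[of k] by (simp add: c_def tm_def field_simps)
  qed
  ultimately show ?thesis by simp
qed

text \<open>The Lyapunov function converges, and every part of it other than the distance term tends
  to 0; dividing by \<open>c k\<close>, whose limit \<open>C\<close> is positive, isolates the
  distance.\<close>

lemma z_dist_convergent:
  assumes xs: "xs \<in> zer_op G T"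
  shows "convergent (\<lambda>k. (norm (z k - xs))\<^sup>2)"
proof -
  have s: "summable (\<lambda>k. 5 * \<eta> * ((tm (Suc k))\<^sup>2 * p (Suc k) + (tm (Suc k))\<^sup>2 * e2 (Suc k)) + 7 * \<eta> * ((tm k)\<^sup>2 * p k + (tm k)\<^sup>2 * e2 k))"
    by (intro summable_add summable_mult sum_p sum_e sum_p[THEN summable_Suc_iff[THEN iffD2]] sum_e[THEN summable_Suc_iff[THEN iffD2]])
  have "Vb xs (Suc k) + 0 \<le> Vb xs k + (5 * \<eta> * ((tm (Suc k))\<^sup>2 * p (Suc k) + (tm (Suc k))\<^sup>2 * e2 (Suc k)) + 7 * \<eta> * ((tm k)\<^sup>2 * p k + (tm k)\<^sup>2 * e2 k))" for k
  proof -
    have "0 \<le> \<eta> / 4 * (real k + 1) * tm (Suc k) * (norm (u (Suc k) - u k))\<^sup>2" "0 \<le> \<eta> * (real k + 1) / (4 * (s - 2)) * (norm (w k))\<^sup>2"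
      using eta_pos s_gt tm_ge[of "Suc k"] by auto
    with Vb_step[OF xs, of k] show ?thesis by (simp add: distrib_left mult.assoc)
  qed
  then have "convergent (Vb xs)"
    using quasi_decreasing_convergent(1)[of "Vb xs" "\<lambda>_. 0", OF _ _ s, of 0] Vb_nonneg[OF xs] by auto
  then obtain l where l: "Vb xs \<longlonglongrightarrow> l" by (auto simp: convergent_def)
  have "(\<lambda>k. 2 * (Vb xs k - E k + \<eta> * s\<^sup>2 / 3 * (norm (w k))\<^sup>2) / c k) \<longlonglongrightarrow> 2 * (l - 0 + \<eta> * s\<^sup>2 / 3 * 0) / C"
    by (intro tendsto_intros l E_tendsto w_sq_tendsto c_tendsto) (use C_pos in auto)
  moreover have "2 * (Vb xs k - E k + \<eta> * s\<^sup>2 / 3 * (norm (w k))\<^sup>2) / c k = (norm (z k - xs))\<^sup>2" for k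
    using c_ge[of k] C_pos by (simp add: Vb_def V_def)
  ultimately show ?thesis by (auto simp: convergent_def)
qed

theorem iterates_converge:
  assumes cl: "closed (gra_op G T)" and ne: "zer_op G T \<noteq> {}"
  shows "\<exists>l \<in> zer_op G T. x \<longlonglongrightarrow> l \<and> y \<longlonglongrightarrow> l \<and> z \<longlonglongrightarrow> l"
proof -
  obtain xs where xs: "xs \<in> zer_op G T" using ne by auto
  have w0: "w \<longlonglongrightarrow> 0"
    using tendsto_real_sqrt[OF w_sq_tendsto] by (simp add: tendsto_norm_zero_iff)
  have D0: "(\<lambda>k. x k - z k) \<longlonglongrightarrow> 0"
    using tendsto_real_sqrt[OF x_minus_z_asymptotics(1)] by (simp add: tendsto_norm_zero_iff)
  have "bounded (range z)"
  proof -
    obtain M where M: "\<And>k. (norm (z k - xs))\<^sup>2 \<le> M"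
      using convergent_imp_Bseq[OF z_dist_convergent[OF xs]] unfolding Bseq_def by (force simp: abs_le_iff)
    have "dist xs (z k) \<le> sqrt M" for k
      using real_le_rsqrt[OF M[of k]] by (simp add: dist_norm norm_minus_commute)
    then show ?thesis unfolding bounded_def by auto
  qed
  then obtain l r where r: "strict_mono r" and zl: "(z \<circ> r) \<longlonglongrightarrow> l"
    using bounded_imp_convergent_subsequence by blast
  have xl: "(\<lambda>n. (x \<circ> r) n) \<longlonglongrightarrow> l"
    using tendsto_add[OF LIMSEQ_subseq_LIMSEQ[OF D0 r] zl] by (simp add: o_def)
  have "(\<lambda>n. ((x \<circ> r) n, (w \<circ> r) n)) \<longlonglongrightarrow> (l, 0)"
    by (intro tendsto_Pair xl LIMSEQ_subseq_LIMSEQ[OF w0 r])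
  then have "(l, 0) \<in> gra_op G T"
    using closed_sequentially[OF cl, of "\<lambda>n. ((x \<circ> r) n, (w \<circ> r) n)"] graph_w by simp
  then have l: "l \<in> zer_op G T" by (auto simp: gra_op_def zer_op_def)
  \<comment> \<open>The cluster point is itself a zero and may serve as reference point: the whole
    sequence of distances to it converges, with limit 0 along the subsequence.\<close>
  obtain L' where L': "(\<lambda>k. (norm (z k - l))\<^sup>2) \<longlonglongrightarrow> L'"
    using z_dist_convergent[OF l] by (auto simp: convergent_def)
  have "(\<lambda>n. (norm ((z \<circ> r) n - l))\<^sup>2) \<longlonglongrightarrow> (norm (l - l))\<^sup>2"
    by (intro tendsto_intros zl)
  moreover have "(\<lambda>n. (norm ((z \<circ> r) n - l))\<^sup>2) \<longlonglongrightarrow> L'"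
    using LIMSEQ_subseq_LIMSEQ[OF L' r] by (simp add: o_def)
  ultimately have "(norm (l - l))\<^sup>2 = L'" by (rule LIMSEQ_unique)
  then have "(\<lambda>k. z k - l) \<longlonglongrightarrow> 0"
    using tendsto_real_sqrt[OF L'] by (simp add: tendsto_norm_zero_iff)
  then have z: "z \<longlonglongrightarrow> l" by (rule LIM_zero_cancel)
  then have x: "x \<longlonglongrightarrow> l" using tendsto_add[OF D0 z] by simp
  have "(\<lambda>k. (norm (x k - y k))\<^sup>2) \<longlonglongrightarrow> 0"
  proof (rule tendsto_sandwich[OF _ _ tendsto_const])
    have "(\<lambda>k. 1 / L\<^sup>2 * ((tm k)\<^sup>2 * p k)) \<longlonglongrightarrow> 1 / L\<^sup>2 * 0"
      by (intro tendsto_intros summable_LIMSEQ_zero sum_p)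
    then show "(\<lambda>k. 1 / L\<^sup>2 * ((tm k)\<^sup>2 * p k)) \<longlonglongrightarrow> 0" by simp
    have "1 \<le> (tm k)\<^sup>2" for k using tm_ge[of k] by simp
    then show "\<forall>\<^sub>F k in sequentially. (norm (x k - y k))\<^sup>2 \<le> 1 / L\<^sup>2 * ((tm k)\<^sup>2 * p k)"
      using L_pos by (intro always_eventually allI) (simp add: p_def mult_le_cancel_right1)
  qed auto
  then have "(\<lambda>k. x k - y k) \<longlonglongrightarrow> 0"
    using tendsto_real_sqrt[of "\<lambda>k. (norm (x k - y k))\<^sup>2" 0] by (simp add: tendsto_norm_zero_iff)
  from tendsto_diff[OF x this] have "y \<longlonglongrightarrow> l" by simp
  with x z l show ?thesis by blast
qed

end

section \<open>Descent in expectation\<close>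

text \<open>Only total expectations occur. The condition with \<open>\<Lambda> - 16\<close> makes
  the decay of \<open>Dm\<close> beat the growth of \<open>c\<close>, and \<open>b k\<close> pays
  for the term with \<open>\<Theta>\<close>.\<close>

lemma (in prob_space) descent_in_expectation:
  fixes A P Er S Dm :: "nat \<Rightarrow> 'a \<Rightarrow> real" and b c d \<epsilon> :: "nat \<Rightarrow> real"
  assumes meas: "\<And>k. A k \<in> borel_measurable M" "\<And>k. P k \<in> borel_measurable M" "\<And>k. Er k \<in> borel_measurable M"
      "\<And>k. S k \<in> borel_measurable M" "\<And>k. Dm k \<in> borel_measurable M"
    and nn: "\<And>k \<omega>. 0 \<le> A k \<omega>" "\<And>k \<omega>. 0 \<le> P k \<omega>" "\<And>k \<omega>. 0 \<le> Er k \<omega>" "\<And>k \<omega>. 0 \<le> S k \<omega>" "\<And>k \<omega>. 0 \<le> Dm k \<omega>"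
    and init: "integrable M (A 0)" "\<And>\<omega>. Er 0 \<omega> = 0" "\<And>\<omega>. Dm 0 \<omega> = 0"
    and P_le: "\<And>k \<omega>. P k \<omega> \<le> m * A k \<omega>"
    and step: "\<And>k \<omega>. A (Suc k) \<omega> + S k \<omega> \<le> A k \<omega> - b k * P k \<omega> + 5 * c (Suc k) * Er (Suc k) \<omega> + 7 * c k * Er k \<omega>"
    and EB1: "\<And>k. (\<integral>\<^sup>+\<omega>. ennreal (Er (Suc k) \<omega>) \<partial>M) \<le> (\<integral>\<^sup>+\<omega>. ennreal (Dm (Suc k) \<omega>) \<partial>M)"
    and EB2: "\<And>k. (\<integral>\<^sup>+\<omega>. ennreal (Dm (Suc k) \<omega>) \<partial>M)
        \<le> (\<integral>\<^sup>+\<omega>. ennreal ((1 - \<kappa>) * Dm k \<omega> + \<Theta> * P k \<omega> + d k) \<partial>M)"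
    and const: "\<kappa> \<le> 1" "0 \<le> \<Theta>" "\<And>k. 0 \<le> d k" "5 \<le> \<Lambda>" "\<And>k. 0 \<le> c k"
      "\<And>k. c (Suc k) * \<Lambda> * (1 - \<kappa>) \<le> c k * (\<Lambda> - 16)"
      "\<And>k. c (Suc k) * \<Lambda> * \<Theta> \<le> b k" "\<And>k. c (Suc k) * \<Lambda> * d k \<le> \<epsilon> k" "summable \<epsilon>"
  shows "AE \<omega> in M. summable (\<lambda>k. S k \<omega>)" "AE \<omega> in M. summable (\<lambda>k. c k * Er k \<omega>)"
proof -
  note [measurable] = meas
  have b_nn: "0 \<le> b k" for k
    using const(7)[of k] const(2,4,5) by (meson mult_nonneg_nonneg order_trans zero_le_numeral)
  have int_P: "integrable M (P k)" if "integrable M (A k)" for k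
    by (rule Bochner_Integration.integrable_bound[OF integrable_mult_right[OF that, of m]])
       (use nn in \<open>auto simp: abs_mult intro!: AE_I2 order_trans[OF P_le] mult_right_mono\<close>)
  have Dm_Suc: "integrable M (Dm (Suc k))"
       "(\<integral>\<omega>. Dm (Suc k) \<omega> \<partial>M) \<le> (1 - \<kappa>) * (\<integral>\<omega>. Dm k \<omega> \<partial>M) + \<Theta> * (\<integral>\<omega>. P k \<omega> \<partial>M) + d k"
    if "integrable M (A k)" "integrable M (Dm k)" for k
  proof -
    note i = int_P[OF that(1)] that(2)
    have j: "integrable M (\<lambda>\<omega>. (1 - \<kappa>) * Dm k \<omega> + \<Theta> * P k \<omega> + d k)" using i by auto
    have "0 \<le> (1 - \<kappa>) * Dm k \<omega> + \<Theta> * P k \<omega> + d k" for \<omega> using nn const by auto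
    note * = integral_le_of_nn_integral_le[OF meas(5) nn(5) j this EB2]
    show "integrable M (Dm (Suc k))" by (rule *)
    show "(\<integral>\<omega>. Dm (Suc k) \<omega> \<partial>M) \<le> (1 - \<kappa>) * (\<integral>\<omega>. Dm k \<omega> \<partial>M) + \<Theta> * (\<integral>\<omega>. P k \<omega> \<partial>M) + d k"
      using *(2) i by (simp add: prob_space)
  qed
  have Er: "integrable M (Er k) \<and> (\<integral>\<omega>. Er k \<omega> \<partial>M) \<le> (\<integral>\<omega>. Dm k \<omega> \<partial>M)" if "integrable M (Dm k)" for k
  proof (cases k)
    case 0
    have "Er 0 = (\<lambda>_. 0)" "Dm 0 = (\<lambda>_. 0)" using init by auto
    then show ?thesis using 0 by simp
  next
    case (Suc j)
    then show ?thesis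
      using integral_le_of_nn_integral_le[OF meas(3) nn(3) that nn(5), of k] EB1[of j] by simp
  qed
  have AS_Suc: "integrable M (\<lambda>\<omega>. A (Suc k) \<omega> + S k \<omega>)" if "integrable M (A k)" "integrable M (Dm k)" for k
  proof (rule Bochner_Integration.integrable_bound)
    show "integrable M (\<lambda>\<omega>. A k \<omega> - b k * P k \<omega> + 5 * c (Suc k) * Er (Suc k) \<omega> + 7 * c k * Er k \<omega>)"
      using that int_P[OF that(1)] Er[OF that(2)] Er[OF Dm_Suc(1)[OF that]] by auto
    show "AE \<omega> in M. norm (A (Suc k) \<omega> + S k \<omega>) \<le> norm (A k \<omega> - b k * P k \<omega> + 5 * c (Suc k) * Er (Suc k) \<omega> + 7 * c k * Er k \<omega>)"
      using nn by (intro AE_I2) (auto intro!: order_trans[OF step] simp: abs_of_nonneg)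
  qed measurable
  have A_Suc: "integrable M (A (Suc k))" "integrable M (S k)" if "integrable M (A k)" "integrable M (Dm k)" for k
    by (rule Bochner_Integration.integrable_bound[OF AS_Suc[OF that]]; use nn in \<open>auto intro!: AE_I2\<close>)+
  \<comment> \<open>Integrability of \<open>A k\<close> and \<open>Dm k\<close> passes to
    \<open>P k\<close> by domination, to \<open>Dm (Suc k)\<close> and \<open>Er (Suc k)\<close> by
    the error condition, and to \<open>A (Suc k)\<close> and \<open>S k\<close> because the descent
    bounds their sum.\<close>
  have int: "integrable M (A k) \<and> integrable M (Dm k)" for k
  proof (induction k)
    case 0
    have "Dm 0 = (\<lambda>_. 0)" using init by auto
    then show ?case using init by simp
  next
    case (Suc k) then show ?case using A_Suc Dm_Suc by auto
  qed
  have intA: "integrable M (A k)" and intD: "integrable M (Dm k)" and intP: "integrable M (P k)"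
     and intE: "integrable M (Er k)" and intS: "integrable M (S k)" for k
    using int[of k] int_P Er A_Suc by auto
  \<comment> \<open>Five units of \<open>\<Lambda>\<close> are reserved for
    \<open>Er (Suc k)\<close>. With the 7 units for \<open>Er k\<close> and the 4 kept in
    \<open>g k\<close>, this accounts for 16 = 5 + 7 + 4.\<close>
  define J where "J k = (\<integral>\<omega>. A k \<omega> \<partial>M) + (\<Lambda> - 5) * c k * (\<integral>\<omega>. Dm k \<omega> \<partial>M)" for k
  define g where "g k = (\<integral>\<omega>. S k \<omega> \<partial>M) + 4 * c k * (\<integral>\<omega>. Dm k \<omega> \<partial>M)" for k
  have nnI: "0 \<le> (\<integral>\<omega>. A k \<omega> \<partial>M)" "0 \<le> (\<integral>\<omega>. S k \<omega> \<partial>M)" "0 \<le> (\<integral>\<omega>. Dm k \<omega> \<partial>M)"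
      "0 \<le> (\<integral>\<omega>. P k \<omega> \<partial>M)" "0 \<le> (\<integral>\<omega>. Er k \<omega> \<partial>M)" for k
    using nn by (auto intro!: integral_nonneg_AE)
  have descent: "J (Suc k) + g k \<le> J k + \<epsilon> k" for k
  proof -
    define EA EA' ES EP ED ED' EE EE' where "EA = (\<integral>\<omega>. A k \<omega> \<partial>M)" and "EA' = (\<integral>\<omega>. A (Suc k) \<omega> \<partial>M)"
      and "ES = (\<integral>\<omega>. S k \<omega> \<partial>M)" and "EP = (\<integral>\<omega>. P k \<omega> \<partial>M)"
      and "ED = (\<integral>\<omega>. Dm k \<omega> \<partial>M)" and "ED' = (\<integral>\<omega>. Dm (Suc k) \<omega> \<partial>M)"
      and "EE = (\<integral>\<omega>. Er k \<omega> \<partial>M)" and "EE' = (\<integral>\<omega>. Er (Suc k) \<omega> \<partial>M)"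
    note defs = EA_def EA'_def ES_def EP_def ED_def ED'_def EE_def EE'_def
    have "(\<integral>\<omega>. A (Suc k) \<omega> + S k \<omega> \<partial>M) \<le> (\<integral>\<omega>. A k \<omega> - b k * P k \<omega> + 5 * c (Suc k) * Er (Suc k) \<omega> + 7 * c k * Er k \<omega> \<partial>M)"
      by (rule integral_mono) (use intA intP intE intS step in auto)
    then have 1: "EA' + ES \<le> EA - b k * EP + 5 * c (Suc k) * EE' + 7 * c k * EE"
      using intA intP intE intS by (simp add: defs)
    have nn': "0 \<le> ED" "0 \<le> ED'" "0 \<le> EP" using nnI by (auto simp: defs)
    have 2: "5 * c (Suc k) * EE' \<le> 5 * c (Suc k) * ED'" "7 * c k * EE \<le> 7 * c k * ED"
      using Er[OF intD] const(5) by (auto simp: defs intro!: mult_left_mono)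
    have "\<Lambda> * c (Suc k) * ED' \<le> \<Lambda> * c (Suc k) * ((1 - \<kappa>) * ED + \<Theta> * EP + d k)"
      using Dm_Suc(2)[OF intA intD, of k] const(4) const(5)[of "Suc k"] by (auto simp: defs intro!: mult_left_mono)
    also have "\<dots> = (c (Suc k) * \<Lambda> * (1 - \<kappa>)) * ED + (c (Suc k) * \<Lambda> * \<Theta>) * EP + c (Suc k) * \<Lambda> * d k"
      by (simp add: algebra_simps)
    also have "\<dots> \<le> (c k * (\<Lambda> - 16)) * ED + b k * EP + \<epsilon> k"
      using const nn' by (intro add_mono mult_right_mono) auto
    finally have 3: "\<Lambda> * c (Suc k) * ED' \<le> (c k * (\<Lambda> - 16)) * ED + b k * EP + \<epsilon> k" .
    show ?thesis
      using 1 2 3 unfolding J_def g_def defs[symmetric] by (simp add: algebra_simps)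
  qed
  have "0 \<le> g k" "0 \<le> J k" for k using nnI[of k] const(4) const(5)[of k] by (auto simp: g_def J_def)
  then have sg: "summable g"
    using quasi_decreasing_convergent(2)[OF descent _ const(9), of 0] by auto
  show "AE \<omega> in M. summable (\<lambda>k. S k \<omega>)"
  proof (rule AE_summable_of_summable_integral[OF intS nn(4)])
    show "summable (\<lambda>k. \<integral>\<omega>. S k \<omega> \<partial>M)"
      by (rule summable_nonneg_le[OF sg]) (use nnI const(5) in \<open>auto simp: g_def\<close>)
  qed
  show "AE \<omega> in M. summable (\<lambda>k. c k * Er k \<omega>)"
  proof (rule AE_summable_of_summable_integral)
    show "summable (\<lambda>k. \<integral>\<omega>. c k * Er k \<omega> \<partial>M)"
    proof (rule summable_nonneg_le[OF sg])
      fix k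
      have "c k * (\<integral>\<omega>. Er k \<omega> \<partial>M) \<le> c k * (\<integral>\<omega>. Dm k \<omega> \<partial>M)"
        using Er[OF intD] const(5) by (auto intro!: mult_left_mono)
      moreover have "0 \<le> c k * (\<integral>\<omega>. Dm k \<omega> \<partial>M)" using const(5) nnI by simp
      ultimately show "(\<integral>\<omega>. c k * Er k \<omega> \<partial>M) \<le> g k"
        using nnI(2)[of k] by (simp add: g_def)
    qed (use const(5) nnI in auto)
  qed (use intE nn const in auto)
qed

section \<open>From the error condition to the almost sure statements\<close>

theorem theorem2:
  fixes M :: "'w measure" and F :: "nat \<Rightarrow> 'w measure"
    and D :: "'d measure" and Gxi :: "'d \<Rightarrow> 'a::euclidean_space \<Rightarrow> 'a"
    and G :: "'a \<Rightarrow> 'a" and T :: "'a \<Rightarrow> 'a set"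
    and L \<sigma> \<rho>n s \<eta> \<kappa> \<Theta> :: real
    and t \<beta> \<gamma> \<delta> :: "nat \<Rightarrow> real"
    and x0 v0 :: 'a
    and x v z ym gm :: "nat \<Rightarrow> 'w \<Rightarrow> 'a"
    and Dm :: "nat \<Rightarrow> 'w \<Rightarrow> real"
  assumes
    \<comment> \<open>standing assumption\<close>
    zer_ne: "zer_op G T \<noteq> {}"
    \<comment> \<open>stochastic oracle: xi ~ D, unbiased\<close>
  and D_prob: "prob_space D"
  and oracle_meas: "\<And>u. (\<lambda>\<xi>. Gxi \<xi> u) \<in> borel_measurable D"
  and oracle_int: "\<And>u. integrable D (\<lambda>\<xi>. Gxi \<xi> u)"
  and oracle_unbiased: "\<And>u. (\<integral>\<xi>. Gxi \<xi> u \<partial>D) = G u"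
    \<comment> \<open>(A0)\<close>
  and sigma_nn: "\<sigma> \<ge> 0"
  and A0: "\<And>u. (\<integral>\<^sup>+\<xi>. ennreal ((norm (Gxi \<xi> u - G u))^2) \<partial>D) \<le> ennreal (\<sigma>^2)"
    \<comment> \<open>(A1) with alpha = 1\<close>
  and L_pos: "L > 0"
  and A1: "\<And>u u'. (norm (G u - G u'))^2 \<le> L^2 * (norm (u - u'))^2"
    \<comment> \<open>(A3) with rho_c = 0\<close>
  and rho_nn: "\<rho>n \<ge> 0"
  and A3: "\<And>u wu u' wu'. (u, wu) \<in> gra_op G T \<Longrightarrow> (u', wu') \<in> gra_op G T \<Longrightarrow>
             inner (wu - wu') (u - u') \<ge> - \<rho>n * (norm (wu - wu'))^2"
  and L_rho: "L * \<rho>n \<le> mu_c s \<kappa> \<Theta>"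
    \<comment> \<open>parameters\<close>
  and s_gt: "s > 7"
  and t_def: "\<And>k. t k = real k + s + 1"
  and kappa_lo: "(2 * s + 1) / (s + 1)^2 < \<kappa>" and kappa_hi: "\<kappa> \<le> 1"
  and Theta_nn: "\<Theta> \<ge> 0"
  and eta_lo: "8 * (s - 1) * \<rho>n / (3 * s - 2) \<le> \<eta>"
  and eta_hi: "\<eta> < lambda_c s \<kappa> \<Theta> / L"
  and eta_rho: "(3 * s^2 - 8 * s - 1) * \<eta> > 8 * (s - 1) * (s - 2) * \<rho>n"
  and gamma_def: "\<And>k. \<gamma> k = \<eta> * (real k + s) / ((s - 2) * (real k + s + 1))"
  and beta_def: "\<And>k. \<beta> k = ((s - 2) * \<eta> / (4 * (s - 1)) + 2 * \<rho>n) * (real k + 1) / (real k + s + 1)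
                          - \<gamma> k / (real k + s + 1)"
  and delta_nn: "\<And>k. \<delta> k \<ge> 0"
  and delta_sum: "summable \<delta>"
    \<comment> \<open>probability space and filtration (F k = information up to iteration k)\<close>
  and M_prob: "prob_space M"
  and F_sub: "\<And>k. subalgebra M (F k)"
  and F_mono: "\<And>k. sets (F k) \<subseteq> sets (F (Suc k))"
    \<comment> \<open>adaptedness; ym k = y^(k-1), gm k = estimator of G y^(k-1), Dm k = Delta_(k-1)\<close>
  and x_meas: "\<And>k. x k \<in> borel_measurable (F k)"
  and v_meas: "\<And>k. v k \<in> borel_measurable (F k)"
  and z_meas: "\<And>k. z k \<in> borel_measurable (F k)"
  and ym_meas: "\<And>k. ym k \<in> borel_measurable (F k)"
  and gm_meas: "\<And>k. gm k \<in> borel_measurable (F k)"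
  and Dm_meas: "\<And>k. Dm k \<in> borel_measurable (F k)"
    \<comment> \<open>VFOG initialisation\<close>
  and v0_in: "v0 \<in> T x0"
  and init: "\<And>\<omega>. x 0 \<omega> = x0 \<and> v 0 \<omega> = v0 \<and> z 0 \<omega> = x0 \<and> ym 0 \<omega> = x0 \<and> gm 0 \<omega> = G x0"
    \<comment> \<open>VFOG iteration, with xhat^k = ((t_k - s)/t_k) x^k + (s/t_k) z^k\<close>
  and y_step: "\<And>k \<omega>. ym (Suc k) \<omega> =
        ((t k - s) / t k) *\<^sub>R x k \<omega> + (s / t k) *\<^sub>R z k \<omega> - (\<eta> - \<beta> k) *\<^sub>R (gm k \<omega> + v k \<omega>)"
  and x_step: "\<And>k \<omega>. x (Suc k) \<omega> \<in> resolvent \<eta> T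
        (((t k - s) / t k) *\<^sub>R x k \<omega> + (s / t k) *\<^sub>R z k \<omega> - \<eta> *\<^sub>R gm (Suc k) \<omega>
          + \<beta> k *\<^sub>R (gm k \<omega> + v k \<omega>))"
  and v_step: "\<And>k \<omega>. v (Suc k) \<omega> =
        (1 / \<eta>) *\<^sub>R (((t k - s) / t k) *\<^sub>R x k \<omega> + (s / t k) *\<^sub>R z k \<omega> - x (Suc k) \<omega>
          + \<beta> k *\<^sub>R (gm k \<omega> + v k \<omega>)) - gm (Suc k) \<omega>"
  and z_step: "\<And>k \<omega>. z (Suc k) \<omega> = z k \<omega> - (\<gamma> k / s) *\<^sub>R (gm k \<omega> + v k \<omega>)"
    \<comment> \<open>error bound condition (EB); e^k = gm (Suc k) - G (ym (Suc k))\<close>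
  and Dm0: "\<And>\<omega>. Dm 0 \<omega> = 0"
  and Dm_nn: "\<And>k \<omega>. Dm k \<omega> \<ge> 0"
  and EB1: "\<And>k. AE \<omega> in M.
        nn_cond_exp M (F k) (\<lambda>\<omega>'. ennreal ((norm (gm (Suc k) \<omega>' - G (ym (Suc k) \<omega>')))^2)) \<omega>
        \<le> nn_cond_exp M (F k) (\<lambda>\<omega>'. ennreal (Dm (Suc k) \<omega>')) \<omega>"
  and EB2: "\<And>k. AE \<omega> in M.
        nn_cond_exp M (F k) (\<lambda>\<omega>'. ennreal (Dm (Suc k) \<omega>')) \<omega>
        \<le> ennreal ((1 - \<kappa>) * Dm k \<omega> + \<Theta> * L^2 * (norm (x k \<omega> - ym k \<omega>))^2 + \<delta> k / (t k)^2)"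
  shows
    "(AE \<omega> in M. summable (\<lambda>k. (real k + 1) * (norm (G (x k \<omega>) + v k \<omega>))^2)
                 \<and> summable (\<lambda>k. (real k + s) * (norm (G (ym k \<omega>) + v k \<omega>))^2))
     \<and> (AE \<omega> in M. (\<lambda>k. (real k)^2 * (norm (G (x k \<omega>) + v k \<omega>))^2) \<longlonglongrightarrow> 0
                 \<and> (\<lambda>k. (real k)^2 * (norm (G (ym k \<omega>) + v k \<omega>))^2) \<longlonglongrightarrow> 0)
     \<and> (closed (gra_op G T) \<longrightarrow>
         (\<exists>xs. xs \<in> borel_measurable M \<and> (\<forall>\<omega>\<in>space M. xs \<omega> \<in> zer_op G T) \<and>
            (AE \<omega> in M. (\<lambda>k. x k \<omega>) \<longlonglongrightarrow> xs \<omega> \<and> (\<lambda>k. ym k \<omega>) \<longlonglongrightarrow> xs \<omega>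
                        \<and> (\<lambda>k. z k \<omega>) \<longlonglongrightarrow> xs \<omega>)))"
proof -
  interpret prob_space M by (rule M_prob)
  have eta_lower: "8 * (s - 1) * \<rho>n \<le> (3 * s - 2) * \<eta>"
    using eta_lo s_gt by (simp add: pos_divide_le_eq mult.commute)
  interpret V: vfog G T L \<rho>n s \<eta> \<beta> \<gamma>
    by standard (fact L_pos A1 rho_nn A3 s_gt eta_lower eta_rho gamma_def beta_def)+
  note eta_pos = V.eta_pos
  obtain xz where xz: "xz \<in> zer_op G T" using zer_ne by auto

  define \<Lambda> where "\<Lambda> = Lambda0 s \<kappa>"
  \<comment> \<open>The last summand of \<open>omega_c\<close>: twice the cost of
    \<open>\<Theta>\<close> after bounding t_k^2 / t_(k-1)^2 by (s + 1)^2 / s^2.\<close>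
  define K where "K = 2 * \<Lambda> * \<Theta> * (s + 1)\<^sup>2 / s\<^sup>2"
  define Q where "Q = s\<^sup>2 - (1 - \<kappa>) * (s + 1)\<^sup>2"
  have s2: "s - 2 > 0" using s_gt by simp
  have Q_pos: "Q > 0"
  proof -
    have "2 * s + 1 < \<kappa> * (s + 1)\<^sup>2" using kappa_lo s_gt by (simp add: pos_divide_less_eq)
    moreover have "Q = \<kappa> * (s + 1)\<^sup>2 - (2 * s + 1)" by (simp add: Q_def power2_eq_square algebra_simps)
    ultimately show ?thesis by simp
  qed
  have Q_le: "Q \<le> s\<^sup>2" using kappa_hi by (simp add: Q_def)
  have Lam_Q: "\<Lambda> * Q = s\<^sup>2 * ((16 * s - 18) / (s - 2))"
    using Q_pos s2 by (simp add: \<Lambda>_def Lambda0_def Q_def[symmetric])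
  \<comment> \<open>The number 16 is the one required by
    \<open>descent_in_expectation\<close>.\<close>
  have ratio: "(16 * s - 18) / (s - 2) \<ge> 16" using s2 by (simp add: pos_le_divide_eq)
  have Lam_Q_ge: "\<Lambda> * Q \<ge> s\<^sup>2 * 16" unfolding Lam_Q using ratio by (intro mult_left_mono) auto
  have Lam_pos: "\<Lambda> > 0"
  proof -
    have "0 < \<Lambda> * Q" using Lam_Q_ge s_gt by (smt (verit) zero_less_power)
    then show ?thesis using Q_pos by (simp add: zero_less_mult_iff)
  qed
  have Lam_ge: "\<Lambda> \<ge> 16"
  proof -
    have "\<Lambda> * Q \<le> \<Lambda> * s\<^sup>2" using Q_le Lam_pos by (intro mult_left_mono) auto
    with Lam_Q_ge have "s\<^sup>2 * 16 \<le> s\<^sup>2 * \<Lambda>" by (simp only: mult.commute[of "s\<^sup>2" \<Lambda>])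
    then show ?thesis using s_gt by simp
  qed
  have K_nn: "K \<ge> 0" using Lam_pos Theta_nn by (simp add: K_def)
  define \<zeta> where "\<zeta> = 1 / 4 - L\<^sup>2 * \<eta>\<^sup>2 * (s + 1) * (12 + K / 2)"
  have zeta_pos: "\<zeta> > 0"
  proof -
    define R where "R = 2 * (1 + omega_c s \<kappa> \<Theta>) * (s + 1)"
    have "2 * (11 * s - 13) / (s - 2) \<ge> 22" using s2 by (simp add: pos_le_divide_eq)
    \<comment> \<open>Since 24 + K = 2 (12 + K / 2), the bound on \<open>\<eta>\<close> yields
      precisely the smallness needed in \<open>lyapunov_step\<close>, with strict inequality and
      hence \<open>\<zeta> > 0\<close>.\<close>
    then have om: "1 + omega_c s \<kappa> \<Theta> \<ge> 24 + K"
      unfolding omega_c_def \<Lambda>_def[symmetric] K_def[symmetric] by linarith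
    have "2 * (24 + K) * (s + 1) \<le> R"
      unfolding R_def using om s_gt by (intro mult_right_mono) auto
    moreover have "0 < 2 * (24 + K) * (s + 1)" using K_nn s_gt by simp
    ultimately have R: "R > 0" "2 * (24 + K) * (s + 1) \<le> R" by auto
    have "\<eta> * L < 1 / sqrt R"
      using eta_hi L_pos unfolding lambda_c_def R_def[symmetric] by (simp only: pos_less_divide_eq)
    then have "(\<eta> * L)\<^sup>2 < (1 / sqrt R)\<^sup>2"
      using eta_pos L_pos by (intro power_strict_mono) auto
    then have "(\<eta> * L)\<^sup>2 * R < 1" using R by (simp add: power_divide pos_less_divide_eq)
    moreover have "(\<eta> * L)\<^sup>2 * (2 * (24 + K) * (s + 1)) \<le> (\<eta> * L)\<^sup>2 * R"
      using R by (intro mult_left_mono) auto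
    ultimately have "(\<eta> * L)\<^sup>2 * (2 * (24 + K) * (s + 1)) < 1" by linarith
    then show ?thesis by (simp add: \<zeta>_def power_mult_distrib algebra_simps)
  qed

  have v_in: "v k \<omega> \<in> T (x k \<omega>)" for k \<omega>
  proof (cases k)
    case 0 then show ?thesis using init v0_in by simp
  next
    case (Suc j)
    obtain v' where v': "v' \<in> T (x (Suc j) \<omega>)"
      "((t j - s) / t j) *\<^sub>R x j \<omega> + (s / t j) *\<^sub>R z j \<omega> - \<eta> *\<^sub>R gm (Suc j) \<omega>
          + \<beta> j *\<^sub>R (gm j \<omega> + v j \<omega>) = x (Suc j) \<omega> + \<eta> *\<^sub>R v'"
      using x_step[where k = j and \<omega> = \<omega>] unfolding resolvent_def by blast
    from v'(2) have "((t j - s) / t j) *\<^sub>R x j \<omega> + (s / t j) *\<^sub>R z j \<omega> - x (Suc j) \<omega>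
          + \<beta> j *\<^sub>R (gm j \<omega> + v j \<omega>) = \<eta> *\<^sub>R (v' + gm (Suc j) \<omega>)"
      by (simp add: algebra_simps)
    \<comment> \<open>The update formula for \<open>v\<close> recovers the very element of
      \<open>T\<close> that witnesses membership in the resolvent, so no uniqueness of the resolvent
      is involved.\<close>
    then have "v (Suc j) \<omega> = v'" unfolding v_step using eta_pos by simp
    then show ?thesis using v' Suc by simp
  qed
  have path: "vfog_path G T L \<rho>n s \<eta> \<beta> \<gamma> (\<lambda>k. x k \<omega>) (\<lambda>k. v k \<omega>) (\<lambda>k. z k \<omega>) (\<lambda>k. ym k \<omega>) (\<lambda>k. gm k \<omega>)" for \<omega>
  proof
    fix k
    have ts: "t k - s = real k + 1" by (simp add: t_def)
    show "v k \<omega> \<in> T (x k \<omega>)" by (rule v_in)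
    show "z (Suc k) \<omega> = z k \<omega> - (\<gamma> k / s) *\<^sub>R (gm k \<omega> + v k \<omega>)" by (rule z_step)
    show "ym (Suc k) \<omega> = ((real k + 1) / (real k + s + 1)) *\<^sub>R x k \<omega> + (s / (real k + s + 1)) *\<^sub>R z k \<omega>
        - (\<eta> - \<beta> k) *\<^sub>R (gm k \<omega> + v k \<omega>)"
      unfolding y_step ts unfolding t_def ..
    have "\<eta> *\<^sub>R v (Suc k) \<omega> = ((real k + 1) / (real k + s + 1)) *\<^sub>R x k \<omega> + (s / (real k + s + 1)) *\<^sub>R z k \<omega> - x (Suc k) \<omega>
          + \<beta> k *\<^sub>R (gm k \<omega> + v k \<omega>) - \<eta> *\<^sub>R gm (Suc k) \<omega>"
      using eta_pos unfolding v_step[of k] ts unfolding t_def by (simp add: scaleR_diff_right)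
    then show "x (Suc k) \<omega> = ((real k + 1) / (real k + s + 1)) *\<^sub>R x k \<omega> + (s / (real k + s + 1)) *\<^sub>R z k \<omega>
        - \<eta> *\<^sub>R (gm (Suc k) \<omega> + v (Suc k) \<omega>) + \<beta> k *\<^sub>R (gm k \<omega> + v k \<omega>)"
      by (simp add: scaleR_add_right)
  qed

  define w where "w k \<omega> = G (x k \<omega>) + v k \<omega>" for k \<omega>
  define u where "u k \<omega> = gm k \<omega> + v k \<omega>" for k \<omega>
  define P where "P k \<omega> = L\<^sup>2 * (norm (x k \<omega> - ym k \<omega>))\<^sup>2" for k \<omega>
  define Er where "Er k \<omega> = (norm (gm k \<omega> - G (ym k \<omega>)))\<^sup>2" for k \<omega>
  define Vb where "Vb k \<omega> = s * V.tm k * (w k \<omega> \<bullet> (x k \<omega> - z k \<omega>)) + V.a k * (norm (w k \<omega>))\<^sup>2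
      + V.c k / 2 * (norm (z k \<omega> - xz))\<^sup>2 - \<eta> * s\<^sup>2 / 3 * (norm (w k \<omega>))\<^sup>2" for k \<omega>
  define c where "c k = \<eta> * (V.tm k)\<^sup>2" for k
  define A where "A k \<omega> = Vb k \<omega> + c k * (7 + K / 2) * P k \<omega>" for k \<omega>
  define S where "S k \<omega> = \<eta> * \<zeta> * ((real k + 1) * V.tm (Suc k) * (norm (u (Suc k) \<omega> - u k \<omega>))\<^sup>2)
      + \<eta> / (4 * (s - 2)) * ((real k + 1) * (norm (w k \<omega>))\<^sup>2)" for k \<omega>
  have c_pos: "c k > 0" for k using eta_pos V.tm_ge[of k] by (simp add: c_def)

  have G_cont: "continuous_on UNIV G"
  proof (rule lipschitz_on_continuous_on)
    show "lipschitz_on L UNIV G"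
    proof (rule lipschitz_onI)
      fix a b :: 'a
      have "(norm (G a - G b))\<^sup>2 \<le> (L * norm (a - b))\<^sup>2" using A1 by (simp add: power_mult_distrib)
      then show "dist (G a) (G b) \<le> L * dist a b"
        using L_pos by (auto simp: dist_norm intro: power2_le_imp_le)
    qed (use L_pos in simp)
  qed
  have G_meas[measurable]: "G \<in> borel_measurable borel" by (rule borel_measurable_continuous_onI[OF G_cont])
  note from_F = measurable_from_subalg[OF F_sub]
  have [measurable]: "x k \<in> borel_measurable M" "v k \<in> borel_measurable M" "z k \<in> borel_measurable M"
      "ym k \<in> borel_measurable M" "gm k \<in> borel_measurable M" "Dm k \<in> borel_measurable M" for k
    using from_F[OF x_meas] from_F[OF v_meas] from_F[OF z_meas] from_F[OF ym_meas] from_F[OF gm_meas] from_F[OF Dm_meas]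
    by auto

  have tower: "(\<integral>\<^sup>+\<omega>. nn_cond_exp M (F k) f \<omega> \<partial>M) = (\<integral>\<^sup>+\<omega>. f \<omega> \<partial>M)" if [measurable]: "f \<in> borel_measurable M" for k f
  proof -
    interpret sub: finite_measure_subalgebra M "F k"
      by unfold_locales (rule F_sub)
    show ?thesis using sub.nn_cond_exp_intg[of "\<lambda>_. 1" f] by simp
  qed

  have descent: "AE \<omega> in M. summable (\<lambda>k. S k \<omega>)" "AE \<omega> in M. summable (\<lambda>k. c k * Er k \<omega>)"
  proof -
    have Vb_nn: "0 \<le> Vb k \<omega>" for k \<omega>
    proof -
      interpret R: vfog_path G T L \<rho>n s \<eta> \<beta> \<gamma> "\<lambda>k. x k \<omega>" "\<lambda>k. v k \<omega>" "\<lambda>k. z k \<omega>" "\<lambda>k. ym k \<omega>" "\<lambda>k. gm k \<omega>"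
        by (rule path)
      have "R.Vb xz k = Vb k \<omega>" by (simp add: R.Vb_def R.V_def R.E_def R.w_def Vb_def w_def)
      then show ?thesis using R.Vb_nonneg[OF xz, of k] by simp
    qed
    have P_nn: "0 \<le> P k \<omega>" for k \<omega> by (simp add: P_def)
    have cP: "0 \<le> c k * (7 + K / 2) * P k \<omega>" for k \<omega> using c_pos[of k] K_nn P_nn by simp
    have step: "A (Suc k) \<omega> + S k \<omega> \<le> A k \<omega> - c k * (K / 2) * P k \<omega> + 5 * c (Suc k) * Er (Suc k) \<omega> + 7 * c k * Er k \<omega>" for k \<omega>
    proof -
      interpret R: vfog_path G T L \<rho>n s \<eta> \<beta> \<gamma> "\<lambda>k. x k \<omega>" "\<lambda>k. v k \<omega>" "\<lambda>k. z k \<omega>" "\<lambda>k. ym k \<omega>" "\<lambda>k. gm k \<omega>"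
        by (rule path)
      have eqs: "R.Vb xz k = Vb k \<omega>" "R.p k = P k \<omega>" "R.e2 k = Er k \<omega>" "R.w k = w k \<omega>" "R.u k = u k \<omega>" for k
        by (simp_all add: R.Vb_def R.V_def R.E_def R.w_def Vb_def w_def R.p_def P_def R.e2_def Er_def R.u_def u_def)
      have "\<zeta> + L\<^sup>2 * \<eta>\<^sup>2 * (s + 1) * (12 + K / 2) \<le> 1 / 4" by (simp add: \<zeta>_def)
      from R.lyapunov_step[OF xz K_nn this, of k] show ?thesis
        unfolding eqs A_def S_def c_def by (simp add: algebra_simps)
    qed
    have tm_ratio: "c (Suc k) \<le> c k * ((s + 1)\<^sup>2 / s\<^sup>2)" for k
    proof -
      have "V.tm (Suc k) \<le> V.tm k * ((s + 1) / s)"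
        using s_gt by (simp add: V.tm_def field_simps)
      then have "(V.tm (Suc k))\<^sup>2 \<le> (V.tm k * ((s + 1) / s))\<^sup>2"
        using V.tm_ge[of "Suc k"] by (intro power_mono) auto
      also have "\<dots> = (V.tm k)\<^sup>2 * ((s + 1)\<^sup>2 / s\<^sup>2)" by (simp add: power_mult_distrib power_divide)
      finally have "\<eta> * (V.tm (Suc k))\<^sup>2 \<le> \<eta> * ((V.tm k)\<^sup>2 * ((s + 1)\<^sup>2 / s\<^sup>2))"
        using eta_pos by (intro mult_left_mono) auto
      then show ?thesis by (simp only: c_def mult.assoc)
    qed
    have k1: "c (Suc k) * \<Lambda> * (1 - \<kappa>) \<le> c k * (\<Lambda> - 16)" for k
    proof -
      have "c (Suc k) * (\<Lambda> * (1 - \<kappa>)) \<le> c k * ((s + 1)\<^sup>2 / s\<^sup>2) * (\<Lambda> * (1 - \<kappa>))"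
        using tm_ratio Lam_pos kappa_hi by (intro mult_right_mono) auto
      also have "\<dots> = c k * (\<Lambda> * ((1 - \<kappa>) * (s + 1)\<^sup>2) / s\<^sup>2)" by simp
      also have "\<Lambda> * ((1 - \<kappa>) * (s + 1)\<^sup>2) = \<Lambda> * s\<^sup>2 - \<Lambda> * Q" by (simp add: Q_def algebra_simps)
      also have "c k * ((\<Lambda> * s\<^sup>2 - \<Lambda> * Q) / s\<^sup>2) \<le> c k * (\<Lambda> - 16)"
      proof (rule mult_left_mono)
        have "\<Lambda> * s\<^sup>2 - \<Lambda> * Q \<le> (\<Lambda> - 16) * s\<^sup>2" using Lam_Q_ge by (simp add: algebra_simps)
        moreover have "s\<^sup>2 > 0" using s_gt by simp
        ultimately show "(\<Lambda> * s\<^sup>2 - \<Lambda> * Q) / s\<^sup>2 \<le> \<Lambda> - 16" by (simp only: pos_divide_le_eq)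
      qed (use c_pos[of k] in simp)
      finally show ?thesis by (simp add: mult.assoc)
    qed
    have k2: "c (Suc k) * \<Lambda> * \<Theta> \<le> c k * (K / 2)" for k
    proof -
      have "c (Suc k) * (\<Lambda> * \<Theta>) \<le> c k * ((s + 1)\<^sup>2 / s\<^sup>2) * (\<Lambda> * \<Theta>)"
        using tm_ratio Lam_pos Theta_nn by (intro mult_right_mono) auto
      also have "\<dots> = c k * (K / 2)" by (simp add: K_def)
      finally show ?thesis by (simp only: mult.assoc)
    qed
    have k3: "c (Suc k) * \<Lambda> * (\<delta> k / (t k)\<^sup>2) \<le> \<eta> * \<Lambda> * \<delta> k" for k
    proof -
      \<comment> \<open>The index shift makes \<open>c (Suc k)\<close> equal to \<eta> t_k^2, which
        cancels the denominator of the error term.\<close>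
      have "t k = V.tm (Suc k)" by (simp add: t_def V.tm_def)
      then show ?thesis using V.tm_ge[of "Suc k"] by (simp add: c_def)
    qed
    \<comment> \<open>Serves only to make \<open>P k\<close> integrable; the constant uses
      \<open>V.tm k > 7\<close> and \<open>7 + K / 2 \<ge> 7\<close>.\<close>
    have P_le: "P k \<omega> \<le> 1 / (\<eta> * 49 * 7) * A k \<omega>" for k \<omega>
    proof -
      have "7\<^sup>2 \<le> (V.tm k)\<^sup>2" using V.tm_ge[of k] by (intro power_mono) auto
      then have "\<eta> * 49 \<le> c k" using eta_pos by (simp add: c_def)
      then have "\<eta> * 49 * 7 * P k \<omega> \<le> c k * (7 + K / 2) * P k \<omega>"
        using eta_pos K_nn P_nn by (intro mult_right_mono mult_mono) auto
      then have "\<eta> * 49 * 7 * P k \<omega> \<le> A k \<omega>" using Vb_nn[of k \<omega>] by (simp add: A_def)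
      then show ?thesis using eta_pos by (simp add: field_simps)
    qed
    have A0: "integrable M (A 0)"
    proof -
      \<comment> \<open>The initialisation is deterministic, so any sample point gives the constant
        value.\<close>
      have "A 0 = (\<lambda>_. A 0 (SOME \<omega>. True))"
        by (rule ext) (simp add: A_def Vb_def w_def P_def init)
      then show ?thesis by (metis integrable_const)
    qed
    have EB1': "(\<integral>\<^sup>+\<omega>. ennreal (Er (Suc k) \<omega>) \<partial>M) \<le> (\<integral>\<^sup>+\<omega>. ennreal (Dm (Suc k) \<omega>) \<partial>M)" for k
      using nn_integral_mono_AE[OF EB1[of k]] by (simp add: tower Er_def)
    have EB2': "(\<integral>\<^sup>+\<omega>. ennreal (Dm (Suc k) \<omega>) \<partial>M)
        \<le> (\<integral>\<^sup>+\<omega>. ennreal ((1 - \<kappa>) * Dm k \<omega> + \<Theta> * P k \<omega> + \<delta> k / (t k)\<^sup>2) \<partial>M)" for k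
      using nn_integral_mono_AE[OF EB2[of k]] by (simp add: tower P_def mult.assoc)
    have meas: "A k \<in> borel_measurable M" "P k \<in> borel_measurable M" "Er k \<in> borel_measurable M"
      "S k \<in> borel_measurable M" "Dm k \<in> borel_measurable M" for k
      unfolding A_def S_def Vb_def w_def u_def P_def Er_def by measurable
    have S_nn: "0 \<le> S k \<omega>" for k \<omega>
      using eta_pos zeta_pos s2 V.tm_ge[of "Suc k"] by (simp add: S_def)
    have A_nn: "0 \<le> A k \<omega>" for k \<omega> using Vb_nn cP by (simp add: A_def)
    have Er_nn: "0 \<le> Er k \<omega>" for k \<omega> by (simp add: Er_def)
    have Er0: "Er 0 \<omega> = 0" for \<omega> by (simp add: Er_def init)
    have d_nn: "0 \<le> \<delta> k / (t k)\<^sup>2" for k using delta_nn by simp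
    have Lam5: "5 \<le> \<Lambda>" using Lam_ge by simp
    have c_nn: "0 \<le> c k" for k using c_pos[of k] by simp
    have sum_d: "summable (\<lambda>k. \<eta> * \<Lambda> * \<delta> k)" by (intro summable_mult delta_sum)
    note D = descent_in_expectation[OF meas A_nn P_nn Er_nn S_nn Dm_nn A0 Er0 Dm0 P_le step EB1' EB2'
        kappa_hi Theta_nn d_nn Lam5 c_nn k1 k2 k3 sum_d]
    show "AE \<omega> in M. summable (\<lambda>k. S k \<omega>)" "AE \<omega> in M. summable (\<lambda>k. c k * Er k \<omega>)" by (fact D)+
  qed

  have good: "AE \<omega> in M. vfog_summable_path G T L \<rho>n s \<eta> \<beta> \<gamma> (\<lambda>k. x k \<omega>) (\<lambda>k. v k \<omega>) (\<lambda>k. z k \<omega>) (\<lambda>k. ym k \<omega>) (\<lambda>k. gm k \<omega>)"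
    using descent
  proof eventually_elim
    case (elim \<omega>)
    interpret R: vfog_path G T L \<rho>n s \<eta> \<beta> \<gamma> "\<lambda>k. x k \<omega>" "\<lambda>k. v k \<omega>" "\<lambda>k. z k \<omega>" "\<lambda>k. ym k \<omega>" "\<lambda>k. gm k \<omega>"
      by (rule path)
    have eqs: "R.e2 k = Er k \<omega>" "R.w k = w k \<omega>" "R.u k = u k \<omega>" for k
      by (simp_all add: R.w_def w_def R.e2_def Er_def R.u_def u_def)
    define X where "X k = (real k + 1) * V.tm (Suc k) * (norm (u (Suc k) \<omega> - u k \<omega>))\<^sup>2" for k
    define Y where "Y k = (real k + 1) * (norm (w k \<omega>))\<^sup>2" for k
    have nn: "0 \<le> X k" "0 \<le> Y k" for k using V.tm_ge[of "Suc k"] by (auto simp: X_def Y_def)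
    define a b where "a = \<eta> * \<zeta>" and "b = \<eta> / (4 * (s - 2))"
    have S: "S k \<omega> = a * X k + b * Y k" for k by (simp add: S_def X_def Y_def a_def b_def)
    have ab: "0 < a" "0 < b" using eta_pos zeta_pos s2 by (auto simp: a_def b_def)
    have "summable (\<lambda>k. a * X k)"
      by (rule summable_nonneg_le[OF elim(1)]) (use nn ab in \<open>auto simp: S\<close>)
    then have "summable X" using ab by (simp add: summable_cmult_iff)
    moreover have "summable (\<lambda>k. b * Y k)"
      by (rule summable_nonneg_le[OF elim(1)]) (use nn ab in \<open>auto simp: S\<close>)
    then have "summable Y" using ab by (simp add: summable_cmult_iff)
    moreover have "summable (\<lambda>k. \<eta> * ((V.tm k)\<^sup>2 * Er k \<omega>))"
      using elim(2) by (simp add: c_def mult.assoc)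
    then have "summable (\<lambda>k. (V.tm k)\<^sup>2 * Er k \<omega>)" using eta_pos by (simp add: summable_cmult_iff)
    ultimately show ?case
      by unfold_locales (simp_all add: eqs X_def[abs_def] Y_def[abs_def])
  qed

  have part_ab: "AE \<omega> in M. (summable (\<lambda>k. (real k + 1) * (norm (G (x k \<omega>) + v k \<omega>))^2)
                 \<and> summable (\<lambda>k. (real k + s) * (norm (G (ym k \<omega>) + v k \<omega>))^2))
       \<and> ((\<lambda>k. (real k)^2 * (norm (G (x k \<omega>) + v k \<omega>))^2) \<longlonglongrightarrow> 0
                 \<and> (\<lambda>k. (real k)^2 * (norm (G (ym k \<omega>) + v k \<omega>))^2) \<longlonglongrightarrow> 0)"
    using good
  proof eventually_elim
    case (elim \<omega>)
    interpret R: vfog_summable_path G T L \<rho>n s \<eta> \<beta> \<gamma> "\<lambda>k. x k \<omega>" "\<lambda>k. v k \<omega>" "\<lambda>k. z k \<omega>" "\<lambda>k. ym k \<omega>" "\<lambda>k. gm k \<omega>"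
      by (rule elim)
    show ?case using R.sum_w R.sum_Gy R.w_rate R.Gy_rate by (simp add: R.w_def)
  qed

  have part_c: "\<exists>xs. xs \<in> borel_measurable M \<and> (\<forall>\<omega>\<in>space M. xs \<omega> \<in> zer_op G T) \<and>
            (AE \<omega> in M. (\<lambda>k. x k \<omega>) \<longlonglongrightarrow> xs \<omega> \<and> (\<lambda>k. ym k \<omega>) \<longlonglongrightarrow> xs \<omega> \<and> (\<lambda>k. z k \<omega>) \<longlonglongrightarrow> xs \<omega>)"
    if cl: "closed (gra_op G T)"
  proof -
    have "zer_op G T = (\<lambda>a. (a, 0)) -` gra_op G T" by (auto simp: zer_op_def gra_op_def)
    moreover have "closed ((\<lambda>a. (a, 0)) -` gra_op G T)"
      by (intro closed_vimage cl continuous_intros)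
    ultimately have "closed (zer_op G T)" by simp
    then have [measurable]: "zer_op G T \<in> sets borel" by auto
    define xl where "xl \<omega> = lim (\<lambda>k. x k \<omega>)" for \<omega>
    have [measurable]: "xl \<in> borel_measurable M" unfolding xl_def by measurable
    \<comment> \<open>Off the good event \<open>lim\<close> may be arbitrary; replacing it there by
      a fixed zero keeps values in the zero set everywhere, and closedness of that set keeps the
      case distinction measurable.\<close>
    define xs where "xs \<omega> = (if xl \<omega> \<in> zer_op G T then xl \<omega> else xz)" for \<omega>
    have "xs \<in> borel_measurable M" unfolding xs_def by measurable
    moreover have "\<forall>\<omega>\<in>space M. xs \<omega> \<in> zer_op G T" using xz by (simp add: xs_def)
    moreover have "AE \<omega> in M. (\<lambda>k. x k \<omega>) \<longlonglongrightarrow> xs \<omega> \<and> (\<lambda>k. ym k \<omega>) \<longlonglongrightarrow> xs \<omega> \<and> (\<lambda>k. z k \<omega>) \<longlonglongrightarrow> xs \<omega>"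
      using good
    proof eventually_elim
      case (elim \<omega>)
      interpret R: vfog_summable_path G T L \<rho>n s \<eta> \<beta> \<gamma> "\<lambda>k. x k \<omega>" "\<lambda>k. v k \<omega>" "\<lambda>k. z k \<omega>" "\<lambda>k. ym k \<omega>" "\<lambda>k. gm k \<omega>"
        by (rule elim)
      obtain l where l: "l \<in> zer_op G T" "(\<lambda>k. x k \<omega>) \<longlonglongrightarrow> l" "(\<lambda>k. ym k \<omega>) \<longlonglongrightarrow> l" "(\<lambda>k. z k \<omega>) \<longlonglongrightarrow> l"
        using R.iterates_converge[OF cl zer_ne] by blast
      have "xl \<omega> = l" using l(2) by (simp add: xl_def limI)
      then show ?case using l by (simp add: xs_def)
    qed
    ultimately show ?thesis by blast
  qed
  show ?thesis using part_ab part_c by (auto simp: AE_conj_iff)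
qed

end
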